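(* Let $\boldsymbol{A}_1,\ldots,\boldsymbol{A}_K\in\mathbb{S}^N$ be real symmetric matrices, where $A_{i,j,k}$ denotes the $(i,j)$ entry of $\boldsymbol{A}_k$, let $\boldsymbol{b}_1,\ldots,\boldsymbol{b}_K\in\mathbb{R}^N$, where $b_{i,k}$ denotes the $i$th entry of $\boldsymbol{b}_k$, and let $c_1,\ldots,c_K\in\mathbb{R}$. Let $\Xi_i\subseteq\mathbb{R}$ for $i\in[N]$. For each $i\in[N]$ and $l\in[L_i]$ let $f_{i,l}:\Xi_i\to\mathbb{R}$ be an arbitrary function and let $\underline{\gamma}_{i,l}\le\overline{\gamma}_{i,l}$ be real scalars. For each $(i,j)\in[N]_2$ and $l\in[L_{i,j}]$ let $f_{i,j,l}:\Xi_i\times\Xi_j\to\mathbb{R}$ be a submodular function and $\gamma_{i,j,l}\in\mathbb{R}$. Let $$\mathcal{P}_{\mathrm{uni}}\cap\mathcal{P}_{\mathrm{bi\text{-}sub}}=\Big\{\mathbb{P}\in\mathcal{P}\big(\textstyle\prod_{i\in[N]}\Xi_i\big)\ \Big|\ \mathbb{E}_{\mathbb{P}}[f_{i,l}(\tilde{\xi}_i)]\in[\underline{\gamma}_{i,l},\overline{\gamma}_{i,l}]\ \forall l\in[L_i],\forall i\in[N],\ \ \mathbb{E}_{\mathbb{P}}[f_{i,j,l}(\tilde{\xi}_i,\tilde{\xi}_j)]\le\gamma_{i,j,l}\ \forall l\in[L_{i,j}],\forall (i,j)\in[N]_2\Big\}$$ and $$\rho^*:=\sup_{\mathbb{P}\in\mathcal{P}_{\mathrm{uni}}\cap\mathcal{P}_{\mathrm{bi\text{-}sub}}}\mathbb{E}_{\mathbb{P}}\Big[\max_{k\in[K]}\big(\tilde{\boldsymbol{\xi}}'\boldsymbol{A}_k\tilde{\boldsymbol{\xi}}+\boldsymbol{b}_k'\tilde{\boldsymbol{\xi}}+c_k\big)\Big].$$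 Suppose the off-diagonal entries of $\boldsymbol{A}_k$ are nonnegative for each $k\in[K]$. When $\Xi_i$ is discrete and finite for each $i\in[N]$, $\rho^*$ is given by the optimal value of the polynomial sized linear program in the decision variables $\lambda_k$, $\lambda_{i,k}(\xi_i)$, $\lambda_{i,j,k}(\xi_i,\xi_j)$ (for $k\in[K]$; $i\in[N]$, $\xi_i\in\Xi_i$; respectively $(i,j)\in[N]_2$, $\xi_i\in\Xi_i$, $\xi_j\in\Xi_j$): $$\max_{\boldsymbol{\lambda}}\ \sum_{k\in[K]}\Big(\sum_{(i,j)\in[N]_2}\sum_{\xi_i\in\Xi_i}\sum_{\xi_j\in\Xi_j}2A_{i,j,k}\,\xi_i\xi_j\,\lambda_{i,j,k}(\xi_i,\xi_j)+\sum_{i\in[N]}\sum_{\xi_i\in\Xi_i}\big(A_{i,i,k}\xi_i^2+b_{i,k}\xi_i\big)\lambda_{i,k}(\xi_i)+c_k\lambda_k\Big)$$ subject to $$\sum_{k\in[K]}\lambda_k=1,$$ $$\sum_{\xi_i\in\Xi_i}\lambda_{i,k}(\xi_i)=\lambda_k,\quad\forall i\in[N],\forall k\in[K],$$ $$\underline{\gamma}_{i,l}\le\sum_{k\in[K]}\sum_{\xi_i\in\Xi_i}f_{i,l}(\xi_i)\lambda_{i,k}(\xi_i)\le\overline{\gamma}_{i,l},\quad\forall l\in[L_i],\forall i\in[N],$$ $$\sum_{\xi_i\in\Xi_i}\lambda_{i,j,k}(\xi_i,\xi_j)=\lambda_{j,k}(\xi_j),\quad\forall\xi_j\in\Xi_j,\forall(i,j)\in[N]_2,\forall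 k\in[K],$$ $$\sum_{\xi_j\in\Xi_j}\lambda_{i,j,k}(\xi_i,\xi_j)=\lambda_{i,k}(\xi_i),\quad\forall\xi_i\in\Xi_i,\forall(i,j)\in[N]_2,\forall k\in[K],$$ $$\sum_{k\in[K]}\sum_{\xi_i\in\Xi_i}\sum_{\xi_j\in\Xi_j}f_{i,j,l}(\xi_i,\xi_j)\lambda_{i,j,k}(\xi_i,\xi_j)\le\gamma_{i,j,l},\quad\forall l\in[L_{i,j}],\forall(i,j)\in[N]_2,$$ $$\lambda_k\ge0\ \ \forall k\in[K],\qquad\lambda_{i,k}(\xi_i)\ge0\ \ \forall\xi_i\in\Xi_i,\forall i\in[N],\forall k\in[K],$$ $$\lambda_{i,j,k}(\xi_i,\xi_j)\ge0\ \ \forall\xi_i\in\Xi_i,\forall\xi_j\in\Xi_j,\forall(i,j)\in[N]_2,\forall k\in[K].$$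
   Context: $[N]=\{1,\ldots,N\}$ and $[N]_2=\{(i,j):1\le i<j\le N\}$. $\mathbb{S}^N$ is the set of real symmetric $N\times N$ matrices, and a prime denotes transpose. $\mathcal{P}(\Xi)$ denotes the set of all probability distributions with support contained in $\Xi$; $\tilde{\boldsymbol{\xi}}=(\tilde{\xi}_1,\ldots,\tilde{\xi}_N)$ is a random vector with distribution $\mathbb{P}$. A function $f:\Xi_i\times\Xi_j\to\mathbb{R}$ is submodular if $f(\boldsymbol{\xi})+f(\boldsymbol{\chi})\ge f(\boldsymbol{\xi}\wedge\boldsymbol{\chi})+f(\boldsymbol{\xi}\vee\boldsymbol{\chi})$ for all $\boldsymbol{\xi},\boldsymbol{\chi}\in\Xi_i\times\Xi_j$, where $\wedge$ and $\vee$ are the componentwise minimum and maximum. "Polynomial sized" means that the number of variables and constraints is polynomial in $N$, $K$, $\max_i|\Xi_i|$, $\max_i L_i$ and $\max_{(i,j)}L_{i,j}$. As usual, the supremum over an empty set and the optimal value of an infeasible maximization problem are $-\infty$. *)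

theory Defs
  imports "HOL-Probability.Probability"
begin

definition pairs :: "nat \<Rightarrow> (nat \<times> nat) set" where
  "pairs N = {(i, j). 1 \<le> i \<and> i < j \<and> j \<le> N}"

definition submodular_on :: "real set \<Rightarrow> real set \<Rightarrow> (real \<Rightarrow> real \<Rightarrow> real) \<Rightarrow> bool" where
  "submodular_on X Y f \<longleftrightarrow>
     (\<forall>x\<in>X. \<forall>y\<in>Y. \<forall>x'\<in>X. \<forall>y'\<in>Y.
        f x y + f x' y' \<ge> f (min x x') (min y y') + f (max x x') (max y y'))"

(* Vectors and matrices are functions on the indices 1, ..., N; the index k of A_k and b_k
   comes first, so quadA D k i j is the (i,j) entry of A_k. The numbers of moment functions are
   numU D i = L_i and numB D i j = L_{i,j}. *)
record moment_data =
  dimN :: nat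
  numK :: nat
  quadA :: "nat \<Rightarrow> nat \<Rightarrow> nat \<Rightarrow> real"
  linb :: "nat \<Rightarrow> nat \<Rightarrow> real"
  constc :: "nat \<Rightarrow> real"
  Xi :: "nat \<Rightarrow> real set"
  numU :: "nat \<Rightarrow> nat"
  funU :: "nat \<Rightarrow> nat \<Rightarrow> real \<Rightarrow> real"
  gamma_lower :: "nat \<Rightarrow> nat \<Rightarrow> real"
  gamma_upper :: "nat \<Rightarrow> nat \<Rightarrow> real"
  numB :: "nat \<Rightarrow> nat \<Rightarrow> nat"
  funB :: "nat \<Rightarrow> nat \<Rightarrow> nat \<Rightarrow> real \<Rightarrow> real \<Rightarrow> real"
  gammaB :: "nat \<Rightarrow> nat \<Rightarrow> nat \<Rightarrow> real"

definition valid_data :: "moment_data \<Rightarrow> bool" where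
  "valid_data D \<longleftrightarrow>
     1 \<le> numK D \<and>
     (\<forall>k\<in>{1..numK D}. \<forall>i\<in>{1..dimN D}. \<forall>j\<in>{1..dimN D}. quadA D k i j = quadA D k j i) \<and>
     (\<forall>i\<in>{1..dimN D}. \<forall>l\<in>{1..numU D i}. gamma_lower D i l \<le> gamma_upper D i l) \<and>
     (\<forall>(i, j)\<in>pairs (dimN D). \<forall>l\<in>{1..numB D i j}. submodular_on (Xi D i) (Xi D j) (funB D i j l))"

definition offdiag_nonneg :: "moment_data \<Rightarrow> bool" where
  "offdiag_nonneg D \<longleftrightarrow>
     (\<forall>k\<in>{1..numK D}. \<forall>i\<in>{1..dimN D}. \<forall>j\<in>{1..dimN D}. i \<noteq> j \<longrightarrow> quadA D k i j \<ge> 0)"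

(* A distribution on R^N supported in S is represented by its restriction to S, a probability
   measure on the Borel sets of S. Hence the values of the moment functions outside the sets
   Xi_i are irrelevant, also for measurability; for finite Xi_i every function is integrable. *)
definition distributions_on :: "nat \<Rightarrow> (nat \<Rightarrow> real) set \<Rightarrow> (nat \<Rightarrow> real) measure set" where
  "distributions_on N S =
     {P. prob_space P \<and> sets P = sets (restrict_space (\<Pi>\<^sub>M i\<in>{1..N}. borel) S)}"

definition ambiguity_set :: "moment_data \<Rightarrow> (nat \<Rightarrow> real) measure set" where
  "ambiguity_set D =
     {P \<in> distributions_on (dimN D) (\<Pi>\<^sub>E i\<in>{1..dimN D}. Xi D i).
        (\<forall>i\<in>{1..dimN D}. \<forall>l\<in>{1..numU D i}.
           (\<integral>\<xi>. funU D i l (\<xi> i) \<partial>P) \<in> {gamma_lower D i l..gamma_upper D i l}) \<and>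
        (\<forall>(i, j)\<in>pairs (dimN D). \<forall>l\<in>{1..numB D i j}.
           (\<integral>\<xi>. funB D i j l (\<xi> i) (\<xi> j) \<partial>P) \<le> gammaB D i j l)}"

definition quad_piece :: "moment_data \<Rightarrow> nat \<Rightarrow> (nat \<Rightarrow> real) \<Rightarrow> real" where
  "quad_piece D k \<xi> =
     (\<Sum>i\<in>{1..dimN D}. \<Sum>j\<in>{1..dimN D}. \<xi> i * quadA D k i j * \<xi> j)
     + (\<Sum>i\<in>{1..dimN D}. linb D k i * \<xi> i) + constc D k"

definition rho_star :: "moment_data \<Rightarrow> ereal" where
  "rho_star D =
     (SUP P\<in>ambiguity_set D. ereal (\<integral>\<xi>. (MAX k\<in>{1..numK D}. quad_piece D k \<xi>) \<partial>P))"

datatype sense = Less_eq | Equal | Greater_eq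

fun holds_sense :: "sense \<Rightarrow> real \<Rightarrow> real \<Rightarrow> bool" where
  "holds_sense Less_eq a b \<longleftrightarrow> a \<le> b"
| "holds_sense Equal a b \<longleftrightarrow> a = b"
| "holds_sense Greater_eq a b \<longleftrightarrow> a \<ge> b"

(* Maximization problem with variables named by 'v and constraints named by 'c; sign
   restrictions on variables are listed among the constraints. *)
record ('v, 'c) max_problem =
  vars :: "'v set"
  objective :: "('v \<Rightarrow> real) \<Rightarrow> real"
  constraints :: "'c set"
  lhs :: "'c \<Rightarrow> ('v \<Rightarrow> real) \<Rightarrow> real"
  sense :: "'c \<Rightarrow> sense"
  rhs :: "'c \<Rightarrow> real"

definition linear_form_on :: "'v set \<Rightarrow> (('v \<Rightarrow> real) \<Rightarrow> real) \<Rightarrow> bool" where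
  "linear_form_on V g \<longleftrightarrow> (\<exists>a. \<forall>x. g x = (\<Sum>v\<in>V. a v * x v))"

definition linear_program :: "('v, 'c) max_problem \<Rightarrow> bool" where
  "linear_program M \<longleftrightarrow>
     finite (vars M) \<and> finite (constraints M) \<and> linear_form_on (vars M) (objective M) \<and>
     (\<forall>c\<in>constraints M. linear_form_on (vars M) (lhs M c))"

definition feasible :: "('v, 'c) max_problem \<Rightarrow> ('v \<Rightarrow> real) set" where
  "feasible M = {x. \<forall>c\<in>constraints M. holds_sense (sense M c) (lhs M c x) (rhs M c)}"

definition optimal_value :: "('v, 'c) max_problem \<Rightarrow> ereal" where
  "optimal_value M = (SUP x\<in>feasible M. ereal (objective M x))"

(* Lam0 k = lambda_k, Lam1 i k x = lambda_{i,k}(x), Lam2 i j k x y = lambda_{i,j,k}(x,y) *)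
datatype lp_var = Lam0 nat | Lam1 nat nat real | Lam2 nat nat nat real real

datatype lp_con =
    Total
  | Mass nat nat
  | Uni_lower nat nat
  | Uni_upper nat nat
  | Marginal_snd nat nat nat real
  | Marginal_fst nat nat nat real
  | Bivariate nat nat nat
  | Nonneg lp_var

definition lp_vars :: "moment_data \<Rightarrow> lp_var set" where
  "lp_vars D =
     {Lam0 k | k. k \<in> {1..numK D}} \<union>
     {Lam1 i k x | i k x. i \<in> {1..dimN D} \<and> k \<in> {1..numK D} \<and> x \<in> Xi D i} \<union>
     {Lam2 i j k x y | i j k x y.
        (i, j) \<in> pairs (dimN D) \<and> k \<in> {1..numK D} \<and> x \<in> Xi D i \<and> y \<in> Xi D j}"

definition lp_constraints :: "moment_data \<Rightarrow> lp_con set" where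
  "lp_constraints D =
     {Total} \<union>
     {Mass i k | i k. i \<in> {1..dimN D} \<and> k \<in> {1..numK D}} \<union>
     {Uni_lower i l | i l. i \<in> {1..dimN D} \<and> l \<in> {1..numU D i}} \<union>
     {Uni_upper i l | i l. i \<in> {1..dimN D} \<and> l \<in> {1..numU D i}} \<union>
     {Marginal_snd i j k y | i j k y.
        (i, j) \<in> pairs (dimN D) \<and> k \<in> {1..numK D} \<and> y \<in> Xi D j} \<union>
     {Marginal_fst i j k x | i j k x.
        (i, j) \<in> pairs (dimN D) \<and> k \<in> {1..numK D} \<and> x \<in> Xi D i} \<union>
     {Bivariate i j l | i j l. (i, j) \<in> pairs (dimN D) \<and> l \<in> {1..numB D i j}} \<union>
     Nonneg ` lp_vars D"

definition lp_objective :: "moment_data \<Rightarrow> (lp_var \<Rightarrow> real) \<Rightarrow> real" where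
  "lp_objective D lam =
     (\<Sum>k\<in>{1..numK D}.
        (\<Sum>(i, j)\<in>pairs (dimN D). \<Sum>x\<in>Xi D i. \<Sum>y\<in>Xi D j.
           2 * quadA D k i j * x * y * lam (Lam2 i j k x y))
        + (\<Sum>i\<in>{1..dimN D}. \<Sum>x\<in>Xi D i. (quadA D k i i * x\<^sup>2 + linb D k i * x) * lam (Lam1 i k x))
        + constc D k * lam (Lam0 k))"

fun lp_lhs :: "moment_data \<Rightarrow> lp_con \<Rightarrow> (lp_var \<Rightarrow> real) \<Rightarrow> real" where
  "lp_lhs D Total lam = (\<Sum>k\<in>{1..numK D}. lam (Lam0 k))"
| "lp_lhs D (Mass i k) lam = (\<Sum>x\<in>Xi D i. lam (Lam1 i k x)) - lam (Lam0 k)"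
| "lp_lhs D (Uni_lower i l) lam =
     (\<Sum>k\<in>{1..numK D}. \<Sum>x\<in>Xi D i. funU D i l x * lam (Lam1 i k x))"
| "lp_lhs D (Uni_upper i l) lam =
     (\<Sum>k\<in>{1..numK D}. \<Sum>x\<in>Xi D i. funU D i l x * lam (Lam1 i k x))"
| "lp_lhs D (Marginal_snd i j k y) lam =
     (\<Sum>x\<in>Xi D i. lam (Lam2 i j k x y)) - lam (Lam1 j k y)"
| "lp_lhs D (Marginal_fst i j k x) lam =
     (\<Sum>y\<in>Xi D j. lam (Lam2 i j k x y)) - lam (Lam1 i k x)"
| "lp_lhs D (Bivariate i j l) lam =
     (\<Sum>k\<in>{1..numK D}. \<Sum>x\<in>Xi D i. \<Sum>y\<in>Xi D j. funB D i j l x y * lam (Lam2 i j k x y))"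
| "lp_lhs D (Nonneg v) lam = lam v"

fun lp_sense :: "lp_con \<Rightarrow> sense" where
  "lp_sense Total = Equal"
| "lp_sense (Mass i k) = Equal"
| "lp_sense (Uni_lower i l) = Greater_eq"
| "lp_sense (Uni_upper i l) = Less_eq"
| "lp_sense (Marginal_snd i j k y) = Equal"
| "lp_sense (Marginal_fst i j k x) = Equal"
| "lp_sense (Bivariate i j l) = Less_eq"
| "lp_sense (Nonneg v) = Greater_eq"

fun lp_rhs :: "moment_data \<Rightarrow> lp_con \<Rightarrow> real" where
  "lp_rhs D Total = 1"
| "lp_rhs D (Mass i k) = 0"
| "lp_rhs D (Uni_lower i l) = gamma_lower D i l"
| "lp_rhs D (Uni_upper i l) = gamma_upper D i l"
| "lp_rhs D (Marginal_snd i j k y) = 0"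
| "lp_rhs D (Marginal_fst i j k x) = 0"
| "lp_rhs D (Bivariate i j l) = gammaB D i j l"
| "lp_rhs D (Nonneg v) = 0"

definition moment_lp :: "moment_data \<Rightarrow> (lp_var, lp_con) max_problem" where
  "moment_lp D =
     \<lparr>vars = lp_vars D, objective = lp_objective D, constraints = lp_constraints D,
      lhs = lp_lhs D, sense = lp_sense, rhs = lp_rhs D\<rparr>"

(* N, K, max_i |Xi_i|, max_i L_i and max_(i,j) L_{i,j}; on nat, the supremum of the empty set
   is 0. *)
definition size_parameters :: "moment_data \<Rightarrow> real \<times> real \<times> real \<times> real \<times> real" where
  "size_parameters D =
     (real (dimN D), real (numK D),
      real (SUP i\<in>{1..dimN D}. card (Xi D i)),
      real (SUP i\<in>{1..dimN D}. numU D i),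
      real (SUP (i, j)\<in>pairs (dimN D). numB D i j))"

end

theory Submission
  imports Defs
begin

text \<open>
  Since the sets \<open>Xi D i\<close> are finite, a distribution is a family of weights \<open>p s\<close> on the finitely
  many outcomes \<open>s\<close>. More generally, consider weights \<open>c k s\<close>, the joint law of the random vector and a
  label \<open>k\<close>. Their masses and their univariate and bivariate marginals form a point \<open>lp_point D c\<close>
  which satisfies the marginal constraints of the program, and at which objective and moment
  constraints are expectations under \<open>c\<close>. Both inequalities between the two optimal values come from
  this correspondence.

  A distribution yields an LP point of the same value (\<open>distribution_to_lp_point\<close>) by labelling each
  outcome with a piece \<open>k\<close> that attains the maximum there.

  Conversely, the bivariate variables of a feasible LP point need not be the marginals of any joint
  distribution. For each \<open>k\<close> they are therefore discarded, and only the univariate ones are kept and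
  coupled comonotonically, that is, as quantile functions of one common uniform variable
  (\<open>comonotone_coupling_exists\<close>). This changes no univariate moment and no mass. Among all bivariate
  distributions with given marginals the comonotone one gives every upper orthant its largest possible
  mass, so it minimises the expectation of every submodular function (\<open>comonotone_minimizes\<close>). Hence the
  submodular moment constraints remain satisfied; and because \<open>- 2 a x y\<close> is submodular for
  \<open>a \<ge> 0\<close>, the bilinear terms with nonnegative off-diagonal coefficients do not decrease. Forgetting
  the label \<open>k\<close> gives a distribution in the ambiguity set, and replacing the piece \<open>k\<close> by the maximum
  of all pieces can only increase the value (\<open>lp_point_to_distribution\<close>).

  The size bounds come from counting index sets: no index set involves more than two coordinates, so the
  number of outcomes, which is exponential in the dimension, never enters.
\<close>

section \<open>Submodular functions and upper orthants\<close>

definition predecessor_in :: "real set \<Rightarrow> real \<Rightarrow> real" where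
  "predecessor_in X s = Max {t \<in> X. t < s}"

lemma predecessor_in:
  assumes "finite X" "s \<in> X" "s \<noteq> Min X"
  shows "predecessor_in X s \<in> X" "predecessor_in X s < s"
proof -
  have "Min X \<in> {t \<in> X. t < s}"
    using assms(2,3) Min_in[OF assms(1)] Min_le[OF assms(1,2)] by force
  then have "predecessor_in X s \<in> {t \<in> X. t < s}"
    unfolding predecessor_in_def using assms by (intro Max_in) auto
  then show "predecessor_in X s \<in> X" "predecessor_in X s < s" by auto
qed

text \<open>A telescoping sum over the chain of elements of \<open>X\<close> from its minimum to \<open>x\<close>.\<close>

lemma sum_increments:
  fixes h :: "real \<Rightarrow> real"
  assumes "finite X" "x \<in> X"
  shows "(\<Sum>s\<in>{s\<in>X - {Min X}. s \<le> x}. h s - h (predecessor_in X s)) = h x - h (Min X)"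
  using assms(2)
proof (induction "card {t\<in>X. t < x}" arbitrary: x rule: less_induct)
  case less
  show ?case
  proof (cases "x = Min X")
    case True
    then have "{s\<in>X - {Min X}. s \<le> x} = {}"
      using Min_le[OF assms(1)] by force
    then show ?thesis using True by (simp only: sum.empty)
  next
    case False
    let ?p = "predecessor_in X x"
    note p = predecessor_in[OF assms(1) less.prems False]
    have below: "t \<le> ?p" if "t \<in> X" "t < x" for t
      using assms(1) that by (auto simp: predecessor_in_def)
    have "{t\<in>X. t < ?p} \<subset> {t\<in>X. t < x}" using p by auto
    then have "card {t\<in>X. t < ?p} < card {t\<in>X. t < x}"
      using assms(1) by (intro psubset_card_mono) auto
    note IH = less.hyps[OF this p(1)]
    have "{s\<in>X - {Min X}. s \<le> x} = insert x {s\<in>X - {Min X}. s \<le> ?p}"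
      using False less.prems p below by force
    moreover have "x \<notin> {s\<in>X - {Min X}. s \<le> ?p}" using p by auto
    ultimately show ?thesis using IH assms(1) by simp
  qed
qed

text \<open>
  Abel summation: write \<open>h x\<close> as its value at the minimum plus increments and interchange the sums.
  Sums against \<open>e\<close> are thereby controlled by the sums of \<open>e\<close> over upper sets alone.
\<close>

lemma sum_by_parts:
  fixes h e :: "real \<Rightarrow> real"
  assumes "finite X"
  shows "(\<Sum>x\<in>X. h x * e x) = h (Min X) * (\<Sum>x\<in>X. e x)
    + (\<Sum>s\<in>X - {Min X}. (h s - h (predecessor_in X s)) * (\<Sum>x\<in>{x\<in>X. s \<le> x}. e x))"
proof -
  let ?d = "\<lambda>s. h s - h (predecessor_in X s)"
  have "(\<Sum>x\<in>X. h x * e x) =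
      (\<Sum>x\<in>X. h (Min X) * e x + (\<Sum>s\<in>{s\<in>X - {Min X}. s \<le> x}. ?d s * e x))"
  proof (rule sum.cong[OF refl])
    fix x assume "x \<in> X"
    have "h x * e x = (h (Min X) + (\<Sum>s\<in>{s\<in>X - {Min X}. s \<le> x}. ?d s)) * e x"
      unfolding sum_increments[OF assms \<open>x \<in> X\<close>] by simp
    then show "h x * e x = h (Min X) * e x + (\<Sum>s\<in>{s\<in>X - {Min X}. s \<le> x}. ?d s * e x)"
      by (simp only: distrib_right sum_distrib_right)
  qed
  also have "\<dots> = h (Min X) * (\<Sum>x\<in>X. e x)
      + (\<Sum>x\<in>X. \<Sum>s\<in>{s\<in>X - {Min X}. s \<le> x}. ?d s * e x)"
    by (simp add: sum.distrib sum_distrib_left)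
  also have "(\<Sum>x\<in>X. \<Sum>s\<in>{s\<in>X - {Min X}. s \<le> x}. ?d s * e x)
      = (\<Sum>s\<in>X - {Min X}. \<Sum>x\<in>{x\<in>X. s \<le> x}. ?d s * e x)"
    using assms by (intro sum.swap_restrict) auto
  finally show ?thesis by (simp add: sum_distrib_left)
qed

lemma zero_if_upper_sums_zero:
  fixes e :: "real \<Rightarrow> real"
  assumes "finite X" "\<And>s. s \<in> X \<Longrightarrow> (\<Sum>x\<in>{x\<in>X. s \<le> x}. e x) = 0" "x \<in> X"
  shows "e x = 0"
proof -
  have "{x\<in>X. Min X \<le> x} = X" using assms(1) by auto
  moreover have "Min X \<in> X" using assms(1,3) by (intro Min_in) auto
  ultimately have "(\<Sum>x\<in>X. e x) = 0" using assms(2)[of "Min X"] by simp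
  moreover have "(\<Sum>x\<in>{x\<in>X. s \<le> x}. e x) = 0" if "s \<in> X - {Min X}" for s
    using assms(2) that by blast
  ultimately have "(\<Sum>z\<in>X. (if z = x then 1 else 0) * e z) = 0"
    by (subst sum_by_parts[OF assms(1)]) simp
  moreover have "(\<Sum>z\<in>X. (if z = x then 1 else 0) * e z) = e x"
    using assms(1,3) by (subst sum.remove[of _ x]) auto
  ultimately show ?thesis by simp
qed

text \<open>
  Summation by parts in both variables leaves only the mixed second differences of \<open>f\<close>, multiplied by
  the upper orthant sums of \<open>d\<close>, because the boundary terms contain the vanishing marginals of \<open>d\<close>.
  Submodularity says that these second differences are nonpositive.
\<close>

lemma submodular_sum_nonpos:
  fixes d :: "real \<Rightarrow> real \<Rightarrow> real"
  assumes fin: "finite X" "finite Y" and sub: "submodular_on X Y f"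
    and col: "\<And>y. y \<in> Y \<Longrightarrow> (\<Sum>x\<in>X. d x y) = 0"
    and row: "\<And>x. x \<in> X \<Longrightarrow> (\<Sum>y\<in>Y. d x y) = 0"
    and orth: "\<And>s t. s \<in> X \<Longrightarrow> t \<in> Y \<Longrightarrow> 0 \<le> (\<Sum>x\<in>{x\<in>X. s \<le> x}. \<Sum>y\<in>{y\<in>Y. t \<le> y}. d x y)"
  shows "(\<Sum>x\<in>X. \<Sum>y\<in>Y. f x y * d x y) \<le> 0"
proof -
  let ?D = "\<lambda>s y. \<Sum>x\<in>{x\<in>X. s \<le> x}. d x y"
  let ?g = "\<lambda>s y. f s y - f (predecessor_in X s) y"
  have "(\<Sum>x\<in>X. \<Sum>y\<in>Y. f x y * d x y) = (\<Sum>y\<in>Y. \<Sum>x\<in>X. f x y * d x y)"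
    by (rule sum.swap)
  also have "\<dots> = (\<Sum>y\<in>Y. \<Sum>s\<in>X - {Min X}. ?g s y * ?D s y)"
    using sum_by_parts[OF fin(1), of "\<lambda>x. f x y" "\<lambda>x. d x y" for y]
    by (intro sum.cong[OF refl]) (simp add: col)
  also have "\<dots> = (\<Sum>s\<in>X - {Min X}. \<Sum>y\<in>Y. ?g s y * ?D s y)"
    by (rule sum.swap)
  also have "\<dots> \<le> 0"
  proof (rule sum_nonpos)
    fix s assume s: "s \<in> X - {Min X}"
    note ps = predecessor_in[OF fin(1), of s]
    have "(\<Sum>y\<in>Y. ?D s y) = (\<Sum>x\<in>{x\<in>X. s \<le> x}. \<Sum>y\<in>Y. d x y)"
      by (rule sum.swap)
    also have "\<dots> = 0" by (simp add: row)
    finally have "(\<Sum>y\<in>Y. ?g s y * ?D s y) =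
        (\<Sum>t\<in>Y - {Min Y}. (?g s t - ?g s (predecessor_in Y t)) * (\<Sum>y\<in>{y\<in>Y. t \<le> y}. ?D s y))"
      by (subst sum_by_parts[OF fin(2)]) simp
    also have "\<dots> \<le> 0"
    proof (intro sum_nonpos mult_nonpos_nonneg)
      fix t assume t: "t \<in> Y - {Min Y}"
      note pt = predecessor_in[OF fin(2), of t]
      have "f (predecessor_in X s) t + f s (predecessor_in Y t) \<ge>
          f (min (predecessor_in X s) s) (min t (predecessor_in Y t)) +
          f (max (predecessor_in X s) s) (max t (predecessor_in Y t))"
        using sub s t ps pt unfolding submodular_on_def by blast
      then show "?g s t - ?g s (predecessor_in Y t) \<le> 0"
        using s t ps pt by (simp add: min_def max_def split: if_splits)
      show "0 \<le> (\<Sum>y\<in>{y\<in>Y. t \<le> y}. ?D s y)"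
        using orth[of s t] s t by (subst sum.swap) auto
    qed
    finally show "(\<Sum>y\<in>Y. ?g s y * ?D s y) \<le> 0" .
  qed
  finally show ?thesis .
qed

section \<open>Comonotone couplings\<close>

definition upper_mass :: "real set \<Rightarrow> (real \<Rightarrow> real) \<Rightarrow> real \<Rightarrow> real" where
  "upper_mass X w s = (\<Sum>x\<in>{x\<in>X. s \<le> x}. w x)"

text \<open>
  The quantile is taken from above: \<open>u\<close> is compared with the mass of upper sets, not lower ones. Then
  the event that the quantile is at least \<open>s\<close> is an initial interval of the parameter range, and
  events of this form are nested.
\<close>

definition upper_quantile :: "real set \<Rightarrow> (real \<Rightarrow> real) \<Rightarrow> real \<Rightarrow> real" where
  "upper_quantile X w u = Max {x\<in>X. u \<le> upper_mass X w x}"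

lemma upper_mass_nonneg:
  assumes "\<And>x. x \<in> X \<Longrightarrow> 0 \<le> w x"
  shows "0 \<le> upper_mass X w s"
  unfolding upper_mass_def using assms by (intro sum_nonneg) auto

lemma upper_mass_le_total:
  assumes "finite X" "\<And>x. x \<in> X \<Longrightarrow> 0 \<le> w x"
  shows "upper_mass X w s \<le> (\<Sum>x\<in>X. w x)"
  unfolding upper_mass_def using assms by (intro sum_mono2) auto

text \<open>The second part is the Galois connection between quantiles and upper masses.\<close>

lemma upper_quantile:
  assumes fin: "finite X" and nonneg: "\<And>x. x \<in> X \<Longrightarrow> 0 \<le> w x"
    and u: "0 < u" "u \<le> (\<Sum>x\<in>X. w x)"
  shows "upper_quantile X w u \<in> X"
    and "\<And>s. s \<in> X \<Longrightarrow> s \<le> upper_quantile X w u \<longleftrightarrow> u \<le> upper_mass X w s"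
proof -
  have "X \<noteq> {}" using u by auto
  moreover have "{x\<in>X. Min X \<le> x} = X" using fin by auto
  ultimately have "Min X \<in> {x\<in>X. u \<le> upper_mass X w x}"
    using u fin by (auto simp: upper_mass_def)
  then have "upper_quantile X w u \<in> {x\<in>X. u \<le> upper_mass X w x}"
    unfolding upper_quantile_def using fin by (intro Max_in) auto
  then have q: "upper_quantile X w u \<in> X" "u \<le> upper_mass X w (upper_quantile X w u)" by auto
  then show "upper_quantile X w u \<in> X" by simp
  fix s assume s: "s \<in> X"
  show "s \<le> upper_quantile X w u \<longleftrightarrow> u \<le> upper_mass X w s"
  proof
    assume "s \<le> upper_quantile X w u"
    then have "upper_mass X w (upper_quantile X w u) \<le> upper_mass X w s"
      unfolding upper_mass_def using fin nonneg by (intro sum_mono2) auto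
    then show "u \<le> upper_mass X w s" using q by simp
  next
    assume "u \<le> upper_mass X w s"
    then show "s \<le> upper_quantile X w u"
      unfolding upper_quantile_def using fin s by (intro Max_ge) auto
  qed
qed

lemma upper_quantile_level_sets:
  assumes "finite X" "\<And>x. x \<in> X \<Longrightarrow> 0 \<le> w x" "s \<in> X"
  shows "{u\<in>{0<..(\<Sum>x\<in>X. w x)}. upper_quantile X w u = s} \<in> sets lborel"
proof -
  let ?m = "\<Sum>x\<in>X. w x"
  have "{u\<in>{0<..?m}. upper_quantile X w u = s} =
      {0<..?m} \<inter> {..upper_mass X w s} - (\<Union>x\<in>{x\<in>X. s < x}. {..upper_mass X w x})"
  proof (intro set_eqI)
    fix u
    show "u \<in> {u\<in>{0<..?m}. upper_quantile X w u = s} \<longleftrightarrow>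
        u \<in> {0<..?m} \<inter> {..upper_mass X w s} - (\<Union>x\<in>{x\<in>X. s < x}. {..upper_mass X w x})"
    proof (cases "u \<in> {0<..?m}")
      case True
      note q = upper_quantile[OF assms(1,2), where u = u]
      have "upper_quantile X w u = s \<longleftrightarrow>
          s \<le> upper_quantile X w u \<and> (\<forall>x\<in>X. s < x \<longrightarrow> \<not> x \<le> upper_quantile X w u)"
        using q(1) True by force
      then show ?thesis using q(2) True assms(3) by auto
    qed auto
  qed
  also have "\<dots> \<in> sets lborel"
    using assms(1) by (intro sets.Diff sets.Int sets.finite_UN) auto
  finally show ?thesis .
qed

text \<open>
  The coupling is the law of the vector of quantiles at one parameter \<open>u\<close>, where \<open>u\<close> is
  distributed by Lebesgue measure on the interval from \<open>0\<close> to the total mass \<open>m\<close>. An upper orthant in two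
  coordinates is the intersection of two initial intervals, which is the shorter of the two; this
  gives the minimum in the last conclusion.
\<close>

lemma comonotone_coupling_exists:
  fixes X :: "'i \<Rightarrow> real set" and w :: "'i \<Rightarrow> real \<Rightarrow> real"
  assumes finI: "finite I" and finX: "\<And>i. i \<in> I \<Longrightarrow> finite (X i)"
    and nonneg: "\<And>i x. i \<in> I \<Longrightarrow> x \<in> X i \<Longrightarrow> 0 \<le> w i x"
    and total: "\<And>i. i \<in> I \<Longrightarrow> (\<Sum>x\<in>X i. w i x) = m" and "0 \<le> m"
  obtains c where "\<And>s. 0 \<le> c s" "(\<Sum>s\<in>PiE I X. c s) = m"
    "\<And>i x. i \<in> I \<Longrightarrow> x \<in> X i \<Longrightarrow> (\<Sum>s\<in>{s\<in>PiE I X. s i = x}. c s) = w i x"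
    "\<And>i j x y. i \<in> I \<Longrightarrow> j \<in> I \<Longrightarrow> x \<in> X i \<Longrightarrow> y \<in> X j \<Longrightarrow>
      (\<Sum>s\<in>{s\<in>PiE I X. x \<le> s i \<and> y \<le> s j}. c s) =
      min (upper_mass (X i) (w i) x) (upper_mass (X j) (w j) y)"
proof -
  let ?S = "PiE I X"
  have finS: "finite ?S" using finI finX by (intro finite_PiE) auto
  define q where "q u = (\<lambda>i\<in>I. upper_quantile (X i) (w i) u)" for u
  define c where "c s = measure lborel {u\<in>{0<..m}. q u = s}" for s
  have quant: "upper_quantile (X i) (w i) u \<in> X i"
    "\<And>s. s \<in> X i \<Longrightarrow> s \<le> upper_quantile (X i) (w i) u \<longleftrightarrow> u \<le> upper_mass (X i) (w i) s"
    if "i \<in> I" "u \<in> {0<..m}" for i u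
    using upper_quantile[OF finX[OF that(1)] nonneg[OF that(1)], where u = u] total[OF that(1)] that(2)
    by auto
  have qS: "q u \<in> ?S" if "u \<in> {0<..m}" for u
    using quant(1) that unfolding q_def by auto
  have q_ge: "x \<le> q u i \<longleftrightarrow> u \<le> upper_mass (X i) (w i) x"
    if "u \<in> {0<..m}" "i \<in> I" "x \<in> X i" for u i x
    using quant(2)[OF that(2,1,3)] that(2) unfolding q_def by auto
  have meas: "{u\<in>{0<..m}. q u = s} \<in> sets lborel" if s: "s \<in> ?S" for s
  proof -
    have "{u\<in>{0<..m}. q u = s} =
        {0<..m} \<inter> (\<Inter>i\<in>I. {u\<in>{0<..m}. upper_quantile (X i) (w i) u = s i})"
    proof (intro set_eqI)
      fix u
      have "q u = s \<longleftrightarrow> (\<forall>i\<in>I. upper_quantile (X i) (w i) u = s i)"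
        using s unfolding q_def by (auto simp: fun_eq_iff restrict_def PiE_def extensional_def)
      then show "u \<in> {u\<in>{0<..m}. q u = s} \<longleftrightarrow> u \<in> {0<..m} \<inter>
          (\<Inter>i\<in>I. {u\<in>{0<..m}. upper_quantile (X i) (w i) u = s i})" by auto
    qed
    also have "\<dots> \<in> sets lborel"
    proof (cases "I = {}")
      case False
      have "{u\<in>{0<..m}. upper_quantile (X i) (w i) u = s i} \<in> sets lborel" if "i \<in> I" for i
        using upper_quantile_level_sets[of "X i" "w i" "s i"] finX nonneg total s that
        by (auto simp: PiE_mem)
      then show ?thesis using False finI by (intro sets.Int sets.finite_INT) auto
    qed simp
    finally show ?thesis .
  qed
  have c_sum: "(\<Sum>s\<in>{s\<in>?S. Q s}. c s) = measure lborel {u\<in>{0<..m}. Q (q u)}" for Q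
  proof -
    have "{u\<in>{0<..m}. Q (q u)} = (\<Union>s\<in>{s\<in>?S. Q s}. {u\<in>{0<..m}. q u = s})"
      using qS by auto
    moreover have "measure lborel (\<Union>s\<in>{s\<in>?S. Q s}. {u\<in>{0<..m}. q u = s}) = (\<Sum>s\<in>{s\<in>?S. Q s}. c s)"
      unfolding c_def
    proof (rule measure_finite_Union)
      show "finite {s\<in>?S. Q s}" using finS by auto
      show "(\<lambda>s. {u\<in>{0<..m}. q u = s}) ` {s\<in>?S. Q s} \<subseteq> sets lborel" using meas by auto
      show "disjoint_family_on (\<lambda>s. {u\<in>{0<..m}. q u = s}) {s\<in>?S. Q s}"
        by (auto simp: disjoint_family_on_def)
      fix s
      have "emeasure lborel {u\<in>{0<..m}. q u = s} \<le> emeasure lborel {0<..m}"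
        by (intro emeasure_mono) auto
      also have "\<dots> < \<infinity>" using \<open>0 \<le> m\<close> by simp
      finally show "emeasure lborel {u\<in>{0<..m}. q u = s} \<noteq> \<infinity>" by simp
    qed
    ultimately show ?thesis by simp
  qed
  have interval: "measure lborel {u\<in>{0<..m}. x \<le> q u i \<and> y \<le> q u j} =
      min (upper_mass (X i) (w i) x) (upper_mass (X j) (w j) y)"
    if "i \<in> I" "j \<in> I" "x \<in> X i" "y \<in> X j" for i j x y
  proof -
    have "upper_mass (X i) (w i) x \<le> m"
      using upper_mass_le_total[of "X i" "w i" x] finX nonneg total that by auto
    then have "{u\<in>{0<..m}. x \<le> q u i \<and> y \<le> q u j} =
        {0<..min (upper_mass (X i) (w i) x) (upper_mass (X j) (w j) y)}"
      using q_ge that by auto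
    then show ?thesis
      using upper_mass_nonneg[of "X i" "w i" x] upper_mass_nonneg[of "X j" "w j" y] nonneg that
      by simp
  qed
  have orth: "(\<Sum>s\<in>{s\<in>?S. x \<le> s i \<and> y \<le> s j}. c s) =
      min (upper_mass (X i) (w i) x) (upper_mass (X j) (w j) y)"
    if "i \<in> I" "j \<in> I" "x \<in> X i" "y \<in> X j" for i j x y
    using c_sum interval that by simp
  \<comment> \<open>The marginals have the right upper masses by \<open>orth\<close> with \<open>i = j\<close>, and upper masses determine weights.\<close>
  have marg: "(\<Sum>s\<in>{s\<in>?S. s i = x}. c s) = w i x" if i: "i \<in> I" and x: "x \<in> X i" for i x
  proof -
    have "(\<Sum>s\<in>{s\<in>?S. s i = x}. c s) - w i x = 0"
    proof (rule zero_if_upper_sums_zero[OF finX[OF i] _ x])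
      fix t assume t: "t \<in> X i"
      have "(\<Sum>z\<in>{z\<in>X i. t \<le> z}. \<Sum>s\<in>{s\<in>?S. s i = z}. c s) =
          (\<Sum>z\<in>{z\<in>X i. t \<le> z}. \<Sum>s\<in>{s\<in>{s\<in>?S. t \<le> s i}. s i = z}. c s)"
        by (intro sum.cong refl) auto
      also have "\<dots> = (\<Sum>s\<in>{s\<in>?S. t \<le> s i}. c s)"
        using finS finX[OF i] i by (intro sum.group) auto
      also have "\<dots> = upper_mass (X i) (w i) t"
        using orth[OF i i t t] by simp
      finally show "(\<Sum>z\<in>{z\<in>X i. t \<le> z}. (\<Sum>s\<in>{s\<in>?S. s i = z}. c s) - w i z) = 0"
        by (simp add: sum_subtractf upper_mass_def)
    qed
    then show ?thesis by simp
  qed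
  show thesis
  proof (rule that)
    have "{u\<in>{0<..m}. True} = {0<..m}" by auto
    then show "(\<Sum>s\<in>?S. c s) = m" using c_sum[of "\<lambda>_. True"] \<open>0 \<le> m\<close> by simp
  qed (use orth marg in \<open>auto simp: c_def\<close>)
qed


text \<open>
  For any distribution \<open>q\<close>, the mass of an upper orthant is at most the upper mass of either marginal.
  A distribution \<open>p\<close> with the same marginals whose orthants have the smaller of these two masses
  dominates \<open>q\<close> on all upper orthants, so \<open>submodular_sum_nonpos\<close> applies to the difference \<open>p - q\<close>.
\<close>

lemma comonotone_minimizes:
  fixes p q :: "real \<Rightarrow> real \<Rightarrow> real"
  assumes fin: "finite X" "finite Y" and sub: "submodular_on X Y f"
    and q_nonneg: "\<And>x y. x \<in> X \<Longrightarrow> y \<in> Y \<Longrightarrow> 0 \<le> q x y"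
    and q_fst: "\<And>x. x \<in> X \<Longrightarrow> (\<Sum>y\<in>Y. q x y) = v x"
    and q_snd: "\<And>y. y \<in> Y \<Longrightarrow> (\<Sum>x\<in>X. q x y) = w y"
    and p_fst: "\<And>x. x \<in> X \<Longrightarrow> (\<Sum>y\<in>Y. p x y) = v x"
    and p_snd: "\<And>y. y \<in> Y \<Longrightarrow> (\<Sum>x\<in>X. p x y) = w y"
    and p_orth: "\<And>s t. s \<in> X \<Longrightarrow> t \<in> Y \<Longrightarrow>
      (\<Sum>x\<in>{x\<in>X. s \<le> x}. \<Sum>y\<in>{y\<in>Y. t \<le> y}. p x y) = min (upper_mass X v s) (upper_mass Y w t)"
  shows "(\<Sum>x\<in>X. \<Sum>y\<in>Y. f x y * p x y) \<le> (\<Sum>x\<in>X. \<Sum>y\<in>Y. f x y * q x y)"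
proof -
  have "(\<Sum>x\<in>X. \<Sum>y\<in>Y. f x y * (p x y - q x y)) \<le> 0"
  proof (rule submodular_sum_nonpos[OF fin sub])
    fix s t assume st: "s \<in> X" "t \<in> Y"
    let ?q = "\<Sum>x\<in>{x\<in>X. s \<le> x}. \<Sum>y\<in>{y\<in>Y. t \<le> y}. q x y"
    have "?q \<le> (\<Sum>x\<in>{x\<in>X. s \<le> x}. \<Sum>y\<in>Y. q x y)"
      using fin q_nonneg by (intro sum_mono sum_mono2) auto
    also have "\<dots> = upper_mass X v s"
      unfolding upper_mass_def by (intro sum.cong) (auto simp: q_fst)
    finally have 1: "?q \<le> upper_mass X v s" .
    have "?q = (\<Sum>y\<in>{y\<in>Y. t \<le> y}. \<Sum>x\<in>{x\<in>X. s \<le> x}. q x y)"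
      by (rule sum.swap)
    also have "\<dots> \<le> (\<Sum>y\<in>{y\<in>Y. t \<le> y}. \<Sum>x\<in>X. q x y)"
      using fin q_nonneg by (intro sum_mono sum_mono2) auto
    also have "\<dots> = upper_mass Y w t"
      unfolding upper_mass_def by (intro sum.cong) (auto simp: q_snd)
    finally have "?q \<le> min (upper_mass X v s) (upper_mass Y w t)" using 1 by simp
    then show "0 \<le> (\<Sum>x\<in>{x\<in>X. s \<le> x}. \<Sum>y\<in>{y\<in>Y. t \<le> y}. p x y - q x y)"
      using p_orth[OF st] by (simp add: sum_subtractf)
  qed (simp_all add: sum_subtractf q_fst q_snd p_fst p_snd)
  then show ?thesis by (simp add: right_diff_distrib sum_subtractf)
qed

section \<open>Distributions on a finite product\<close>

text \<open>
  Singletons are Borel sets of the product space, so on a finite set every subset is measurable and a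
  probability measure is determined by its point masses.
\<close>

lemma distributions_on_finite:
  assumes fin: "finite S" and S: "S \<subseteq> (\<Pi>\<^sub>E i\<in>{1..N}. UNIV)"
  shows "P \<in> distributions_on N S \<longleftrightarrow>
    (\<exists>p. (\<forall>s\<in>S. 0 \<le> p s) \<and> (\<Sum>s\<in>S. p s) = (1::real) \<and> P = point_measure S p)"
proof -
  let ?B = "\<Pi>\<^sub>M i\<in>{1..N}. (borel :: real measure)"
  have single: "{s} \<in> sets ?B" if "s \<in> S" for s
  proof -
    have "s \<in> extensional {1..N}" using S that by (auto simp: PiE_def)
    then have "(\<Pi>\<^sub>E i\<in>{1..N}. {s i}) = {s}" by (rule PiE_singleton)
    moreover have "(\<Pi>\<^sub>E i\<in>{1..N}. {s i}) \<in> sets ?B" by (intro sets_PiM_I_finite) auto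
    ultimately show ?thesis by simp
  qed
  have sets_S: "sets (restrict_space ?B S) = Pow S"
  proof
    show "sets (restrict_space ?B S) \<subseteq> Pow S" by (auto simp: sets_restrict_space)
    show "Pow S \<subseteq> sets (restrict_space ?B S)"
    proof
      fix A assume "A \<in> Pow S"
      then have "A \<subseteq> S" by simp
      have "A \<in> sets ?B"
      proof (rule sets.countable)
        show "{s} \<in> sets ?B" if "s \<in> A" for s using single that \<open>A \<subseteq> S\<close> by blast
        show "countable A" using \<open>A \<subseteq> S\<close> fin by (meson countable_finite finite_subset)
      qed
      moreover have "A = S \<inter> A" using \<open>A \<subseteq> S\<close> by blast
      ultimately show "A \<in> sets (restrict_space ?B S)" unfolding sets_restrict_space by blast
    qed
  qed
  show ?thesis
  proof
    assume "P \<in> distributions_on N S"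
    then interpret prob_space P
      unfolding distributions_on_def by auto
    have sets_P: "sets P = Pow S"
      using \<open>P \<in> distributions_on N S\<close> sets_S unfolding distributions_on_def by auto
    then have space_P: "space P = S" using sets_eq_imp_space_eq[of P "count_space S"] by simp
    have "P = point_measure S (\<lambda>s. measure P {s})"
    proof (rule measure_eqI_finite[OF sets_P _ fin])
      show "sets (point_measure S (\<lambda>s. ennreal (measure P {s}))) = Pow S"
        by (simp add: sets_point_measure)
    next
      fix s assume "s \<in> S"
      then show "emeasure P {s} = emeasure (point_measure S (\<lambda>s. ennreal (measure P {s}))) {s}"
        using fin by (simp add: emeasure_point_measure_finite emeasure_eq_measure)
    qed
    moreover have "(\<Sum>s\<in>S. measure P {s}) = 1"
      using finite_measure_eq_sum_singleton[OF fin] prob_space space_P sets_P by simp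
    ultimately show "\<exists>p. (\<forall>s\<in>S. 0 \<le> p s) \<and> (\<Sum>s\<in>S. p s) = (1::real) \<and> P = point_measure S p"
      by (intro exI[of _ "\<lambda>s. measure P {s}"]) auto
  next
    assume "\<exists>p. (\<forall>s\<in>S. 0 \<le> p s) \<and> (\<Sum>s\<in>S. p s) = (1::real) \<and> P = point_measure S p"
    then obtain p where p: "\<And>s. s \<in> S \<Longrightarrow> 0 \<le> p s" "(\<Sum>s\<in>S. p s) = (1::real)" and P: "P = point_measure S p"
      by auto
    have "emeasure P (space P) = (\<Sum>s\<in>S. ennreal (p s))"
      unfolding P space_point_measure using fin by (intro emeasure_point_measure_finite) auto
    also have "\<dots> = 1" using p by (simp add: sum_ennreal)
    finally have "prob_space P" by (rule prob_spaceI)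
    then show "P \<in> distributions_on N S"
      unfolding distributions_on_def using sets_S P by (simp add: sets_point_measure)
  qed
qed

section \<open>The points of the linear program that come from weights on outcomes\<close>

definition outcomes :: "moment_data \<Rightarrow> (nat \<Rightarrow> real) set" where
  "outcomes D = (\<Pi>\<^sub>E i\<in>{1..dimN D}. Xi D i)"

text \<open>
  Read \<open>c k s\<close> as the probability of the outcome \<open>s\<close> together with the label \<open>k\<close>. The LP variables are
  then the probabilities of the label, of the label with one coordinate, and of the label with two
  coordinates.
\<close>

fun lp_point :: "moment_data \<Rightarrow> (nat \<Rightarrow> (nat \<Rightarrow> real) \<Rightarrow> real) \<Rightarrow> lp_var \<Rightarrow> real" where
  "lp_point D c (Lam0 k) = (\<Sum>s\<in>outcomes D. c k s)"
| "lp_point D c (Lam1 i k x) = (\<Sum>s\<in>{s\<in>outcomes D. s i = x}. c k s)"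
| "lp_point D c (Lam2 i j k x y) = (\<Sum>s\<in>{s\<in>outcomes D. s i = x \<and> s j = y}. c k s)"

lemma finite_outcomes:
  assumes "\<forall>i\<in>{1..dimN D}. finite (Xi D i)"
  shows "finite (outcomes D)"
  unfolding outcomes_def using assms by (intro finite_PiE) auto

lemma outcomesD: "s \<in> outcomes D \<Longrightarrow> i \<in> {1..dimN D} \<Longrightarrow> s i \<in> Xi D i"
  unfolding outcomes_def by auto

lemma pairsD:
  assumes "(i, j) \<in> pairs N"
  shows "i \<in> {1..N}" "j \<in> {1..N}" "i \<noteq> j"
  using assms by (auto simp: pairs_def)

lemma finite_pairs: "finite (pairs N)"
  by (rule finite_subset[of _ "{1..N} \<times> {1..N}"]) (auto simp: pairs_def)

lemma sum_lp_point_Lam1: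
  assumes fin: "\<forall>i\<in>{1..dimN D}. finite (Xi D i)" and i: "i \<in> {1..dimN D}"
  shows "(\<Sum>x\<in>Xi D i. h x * lp_point D c (Lam1 i k x)) = (\<Sum>s\<in>outcomes D. h (s i) * c k s)"
proof -
  have "(\<Sum>x\<in>Xi D i. h x * lp_point D c (Lam1 i k x)) =
      (\<Sum>x\<in>Xi D i. \<Sum>s\<in>{s\<in>outcomes D. s i = x}. h (s i) * c k s)"
    by (simp add: sum_distrib_left)
  also have "\<dots> = (\<Sum>s\<in>outcomes D. h (s i) * c k s)"
    using fin i finite_outcomes[OF fin] outcomesD by (intro sum.group) auto
  finally show ?thesis .
qed

lemma sum_lp_point_Lam2_subset:
  assumes fin: "\<forall>i\<in>{1..dimN D}. finite (Xi D i)" and "finite A" "finite B"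
  shows "(\<Sum>x\<in>A. \<Sum>y\<in>B. h x y * lp_point D c (Lam2 i j k x y)) =
    (\<Sum>s\<in>{s\<in>outcomes D. s i \<in> A \<and> s j \<in> B}. h (s i) (s j) * c k s)"
proof -
  let ?S = "{s\<in>outcomes D. s i \<in> A \<and> s j \<in> B}"
  have "(\<Sum>x\<in>A. \<Sum>y\<in>B. h x y * lp_point D c (Lam2 i j k x y)) =
      (\<Sum>(x, y)\<in>A \<times> B. \<Sum>s\<in>{s\<in>outcomes D. s i = x \<and> s j = y}. h (s i) (s j) * c k s)"
    by (simp add: sum_distrib_left sum.cartesian_product)
  also have "\<dots> = (\<Sum>z\<in>A \<times> B. \<Sum>s\<in>{s\<in>?S. (s i, s j) = z}. h (s i) (s j) * c k s)"
    by (intro sum.cong refl) (auto intro!: sum.cong)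
  also have "\<dots> = (\<Sum>s\<in>?S. h (s i) (s j) * c k s)"
    using finite_outcomes[OF fin] assms(2,3) by (intro sum.group) auto
  finally show ?thesis .
qed

lemma sum_lp_point_Lam2:
  assumes fin: "\<forall>i\<in>{1..dimN D}. finite (Xi D i)" and "i \<in> {1..dimN D}" "j \<in> {1..dimN D}"
  shows "(\<Sum>x\<in>Xi D i. \<Sum>y\<in>Xi D j. h x y * lp_point D c (Lam2 i j k x y)) =
    (\<Sum>s\<in>outcomes D. h (s i) (s j) * c k s)"
proof -
  have "{s\<in>outcomes D. s i \<in> Xi D i \<and> s j \<in> Xi D j} = outcomes D"
    using assms outcomesD by auto
  then show ?thesis using sum_lp_point_Lam2_subset[OF fin, of "Xi D i" "Xi D j" h c i j k] assms by simp
qed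

lemma lp_point_marginals:
  assumes fin: "\<forall>i\<in>{1..dimN D}. finite (Xi D i)" and ij: "i \<in> {1..dimN D}" "j \<in> {1..dimN D}"
  shows "(\<Sum>x\<in>Xi D i. lp_point D c (Lam1 i k x)) = lp_point D c (Lam0 k)"
    and "(\<Sum>x\<in>Xi D i. lp_point D c (Lam2 i j k x y)) = lp_point D c (Lam1 j k y)"
    and "(\<Sum>y\<in>Xi D j. lp_point D c (Lam2 i j k x y)) = lp_point D c (Lam1 i k x)"
proof -
  show "(\<Sum>x\<in>Xi D i. lp_point D c (Lam1 i k x)) = lp_point D c (Lam0 k)"
    using sum_lp_point_Lam1[OF fin ij(1), of "\<lambda>_. 1"] by simp
  have "(\<Sum>x\<in>Xi D i. lp_point D c (Lam2 i j k x y)) =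
      (\<Sum>s\<in>{s\<in>outcomes D. s i \<in> Xi D i \<and> s j \<in> {y}}. c k s)"
    using sum_lp_point_Lam2_subset[OF fin, of "Xi D i" "{y}" "\<lambda>_ _. 1"] fin ij by simp
  also have "{s\<in>outcomes D. s i \<in> Xi D i \<and> s j \<in> {y}} = {s\<in>outcomes D. s j = y}"
    using outcomesD ij by auto
  finally show "(\<Sum>x\<in>Xi D i. lp_point D c (Lam2 i j k x y)) = lp_point D c (Lam1 j k y)" by simp
  have "(\<Sum>y\<in>Xi D j. lp_point D c (Lam2 i j k x y)) =
      (\<Sum>s\<in>{s\<in>outcomes D. s i \<in> {x} \<and> s j \<in> Xi D j}. c k s)"
    using sum_lp_point_Lam2_subset[OF fin, of "{x}" "Xi D j" "\<lambda>_ _. 1"] fin ij by simp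
  also have "{s\<in>outcomes D. s i \<in> {x} \<and> s j \<in> Xi D j} = {s\<in>outcomes D. s i = x}"
    using outcomesD ij by auto
  finally show "(\<Sum>y\<in>Xi D j. lp_point D c (Lam2 i j k x y)) = lp_point D c (Lam1 i k x)" by simp
qed

text \<open>This is where symmetry of the matrices enters, as the factor 2 in the objective of the program.\<close>

lemma sum_symmetric_pairs:
  fixes g :: "nat \<Rightarrow> nat \<Rightarrow> real"
  assumes "\<forall>i\<in>{1..N}. \<forall>j\<in>{1..N}. g i j = g j i"
  shows "(\<Sum>i\<in>{1..N}. \<Sum>j\<in>{1..N}. g i j) = (\<Sum>(i, j)\<in>pairs N. 2 * g i j) + (\<Sum>i\<in>{1..N}. g i i)"
  using assms
proof (induction N)
  case 0
  have "pairs 0 = {}" by (auto simp: pairs_def)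
  then show ?case by simp
next
  case (Suc N)
  have pairs: "pairs (Suc N) = pairs N \<union> {1..N} \<times> {Suc N}" by (auto simp: pairs_def)
  have "(\<Sum>(i, j)\<in>pairs (Suc N). 2 * g i j) =
      (\<Sum>(i, j)\<in>pairs N. 2 * g i j) + (\<Sum>(i, j)\<in>{1..N} \<times> {Suc N}. 2 * g i j)"
    unfolding pairs by (rule sum.union_disjoint) (auto simp: finite_pairs, auto simp: pairs_def)
  also have "(\<Sum>(i, j)\<in>{1..N} \<times> {Suc N}. 2 * g i j) = (\<Sum>i\<in>{1..N}. 2 * g i (Suc N))"
    by (simp add: sum.cartesian_product[symmetric])
  also have "\<dots> = (\<Sum>i\<in>{1..N}. g i (Suc N)) + (\<Sum>i\<in>{1..N}. g (Suc N) i)"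
    using Suc.prems by (simp add: sum.distrib[symmetric])
  finally show ?case using Suc.IH Suc.prems by (simp add: sum.distrib)
qed

lemma quad_piece_eq:
  assumes "valid_data D" "k \<in> {1..numK D}"
  shows "quad_piece D k s =
    (\<Sum>(i, j)\<in>pairs (dimN D). 2 * quadA D k i j * s i * s j)
    + (\<Sum>i\<in>{1..dimN D}. quadA D k i i * (s i)\<^sup>2 + linb D k i * s i) + constc D k"
proof -
  have "(\<Sum>i\<in>{1..dimN D}. \<Sum>j\<in>{1..dimN D}. s i * quadA D k i j * s j) =
      (\<Sum>(i, j)\<in>pairs (dimN D). 2 * (s i * quadA D k i j * s j))
      + (\<Sum>i\<in>{1..dimN D}. s i * quadA D k i i * s i)"
    using assms by (intro sum_symmetric_pairs) (auto simp: valid_data_def algebra_simps)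
  then show ?thesis
    unfolding quad_piece_def by (simp add: sum.distrib power2_eq_square ac_simps)
qed

lemma lp_objective_lp_point:
  assumes valid: "valid_data D" and fin: "\<forall>i\<in>{1..dimN D}. finite (Xi D i)"
  shows "lp_objective D (lp_point D c) =
    (\<Sum>k\<in>{1..numK D}. \<Sum>s\<in>outcomes D. quad_piece D k s * c k s)"
  unfolding lp_objective_def
proof (rule sum.cong[OF refl])
  fix k assume k: "k \<in> {1..numK D}"
  let ?I = "{1..dimN D}"
  have "(\<Sum>(i, j)\<in>pairs (dimN D). \<Sum>x\<in>Xi D i. \<Sum>y\<in>Xi D j.
        2 * quadA D k i j * x * y * lp_point D c (Lam2 i j k x y)) =
      (\<Sum>(i, j)\<in>pairs (dimN D). \<Sum>s\<in>outcomes D. 2 * quadA D k i j * s i * s j * c k s)"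
  proof (rule sum.cong[OF refl], clarify)
    fix i j assume ij: "(i, j) \<in> pairs (dimN D)"
    show "(\<Sum>x\<in>Xi D i. \<Sum>y\<in>Xi D j.
        2 * quadA D k i j * x * y * lp_point D c (Lam2 i j k x y)) =
      (\<Sum>s\<in>outcomes D. 2 * quadA D k i j * s i * s j * c k s)"
      by (rule sum_lp_point_Lam2[OF fin pairsD(1,2)[OF ij]])
  qed
  also have "\<dots> = (\<Sum>s\<in>outcomes D. (\<Sum>(i, j)\<in>pairs (dimN D). 2 * quadA D k i j * s i * s j) * c k s)"
    unfolding case_prod_unfold by (subst sum.swap) (simp add: sum_distrib_right)
  finally have 1: "(\<Sum>(i, j)\<in>pairs (dimN D). \<Sum>x\<in>Xi D i. \<Sum>y\<in>Xi D j.
        2 * quadA D k i j * x * y * lp_point D c (Lam2 i j k x y)) =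
      (\<Sum>s\<in>outcomes D. (\<Sum>(i, j)\<in>pairs (dimN D). 2 * quadA D k i j * s i * s j) * c k s)" .
  have "(\<Sum>i\<in>?I. \<Sum>x\<in>Xi D i. (quadA D k i i * x\<^sup>2 + linb D k i * x) * lp_point D c (Lam1 i k x)) =
      (\<Sum>i\<in>?I. \<Sum>s\<in>outcomes D. (quadA D k i i * (s i)\<^sup>2 + linb D k i * s i) * c k s)"
    by (intro sum.cong[OF refl] sum_lp_point_Lam1 fin)
  also have "\<dots> = (\<Sum>s\<in>outcomes D. (\<Sum>i\<in>?I. quadA D k i i * (s i)\<^sup>2 + linb D k i * s i) * c k s)"
    by (subst sum.swap) (simp only: sum_distrib_right)
  finally have 2: "(\<Sum>i\<in>?I. \<Sum>x\<in>Xi D i.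
        (quadA D k i i * x\<^sup>2 + linb D k i * x) * lp_point D c (Lam1 i k x)) =
      (\<Sum>s\<in>outcomes D. (\<Sum>i\<in>?I. quadA D k i i * (s i)\<^sup>2 + linb D k i * s i) * c k s)" .
  have split: "(\<Sum>s\<in>outcomes D. (a s + b s + constc D k) * c k s) = (\<Sum>s\<in>outcomes D. a s * c k s)
      + (\<Sum>s\<in>outcomes D. b s * c k s) + constc D k * lp_point D c (Lam0 k)" for a b
    by (simp only: lp_point.simps distrib_right sum.distrib sum_distrib_left)
  show "(\<Sum>(i, j)\<in>pairs (dimN D). \<Sum>x\<in>Xi D i. \<Sum>y\<in>Xi D j.
        2 * quadA D k i j * x * y * lp_point D c (Lam2 i j k x y)) +
      (\<Sum>i\<in>?I. \<Sum>x\<in>Xi D i. (quadA D k i i * x\<^sup>2 + linb D k i * x) * lp_point D c (Lam1 i k x)) +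
      constc D k * lp_point D c (Lam0 k) = (\<Sum>s\<in>outcomes D. quad_piece D k s * c k s)"
    unfolding 1 2 quad_piece_eq[OF valid k] split ..
qed

text \<open>
  The marginal constraints hold for every \<open>c\<close>; what remains are the moment conditions,
  stated for the law of the outcomes.
\<close>

lemma lp_point_feasible:
  assumes fin: "\<forall>i\<in>{1..dimN D}. finite (Xi D i)"
    and nonneg: "\<And>k s. k \<in> {1..numK D} \<Longrightarrow> s \<in> outcomes D \<Longrightarrow> 0 \<le> c k s"
    and total: "(\<Sum>k\<in>{1..numK D}. \<Sum>s\<in>outcomes D. c k s) = 1"
    and uni: "\<And>i l. i \<in> {1..dimN D} \<Longrightarrow> l \<in> {1..numU D i} \<Longrightarrow>
      (\<Sum>k\<in>{1..numK D}. \<Sum>s\<in>outcomes D. funU D i l (s i) * c k s)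
        \<in> {gamma_lower D i l..gamma_upper D i l}"
    and biv: "\<And>i j l. (i, j) \<in> pairs (dimN D) \<Longrightarrow> l \<in> {1..numB D i j} \<Longrightarrow>
      (\<Sum>k\<in>{1..numK D}. \<Sum>s\<in>outcomes D. funB D i j l (s i) (s j) * c k s) \<le> gammaB D i j l"
  shows "lp_point D c \<in> feasible (moment_lp D)"
proof -
  let ?x = "lp_point D c"
  have "holds_sense (lp_sense r) (lp_lhs D r ?x) (lp_rhs D r)" if r: "r \<in> lp_constraints D" for r
  proof (cases r)
    case (Nonneg v)
    then have "v \<in> lp_vars D" using r unfolding lp_constraints_def by auto
    then have "0 \<le> ?x v" unfolding lp_vars_def using nonneg by (auto intro!: sum_nonneg)
    then show ?thesis using Nonneg by simp
  next
    case Total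
    then show ?thesis using total by simp
  next
    case (Mass i k)
    then have "i \<in> {1..dimN D}" using r unfolding lp_constraints_def by auto
    then show ?thesis using Mass lp_point_marginals(1)[OF fin] by (simp del: lp_point.simps)
  next
    case (Uni_lower i l)
    then have "i \<in> {1..dimN D}" "l \<in> {1..numU D i}" using r unfolding lp_constraints_def by auto
    then show ?thesis using Uni_lower uni sum_lp_point_Lam1[OF fin] by (simp del: lp_point.simps)
  next
    case (Uni_upper i l)
    then have "i \<in> {1..dimN D}" "l \<in> {1..numU D i}" using r unfolding lp_constraints_def by auto
    then show ?thesis using Uni_upper uni sum_lp_point_Lam1[OF fin] by (simp del: lp_point.simps)
  next
    case (Marginal_snd i j k y)
    then have "(i, j) \<in> pairs (dimN D)" using r unfolding lp_constraints_def by auto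
    then show ?thesis using Marginal_snd lp_point_marginals(2)[OF fin] pairsD
      by (simp del: lp_point.simps)
  next
    case (Marginal_fst i j k x)
    then have "(i, j) \<in> pairs (dimN D)" using r unfolding lp_constraints_def by auto
    then show ?thesis using Marginal_fst lp_point_marginals(3)[OF fin] pairsD
      by (simp del: lp_point.simps)
  next
    case (Bivariate i j l)
    then have "(i, j) \<in> pairs (dimN D)" "l \<in> {1..numB D i j}"
      using r unfolding lp_constraints_def by auto
    then show ?thesis using Bivariate biv sum_lp_point_Lam2[OF fin] pairsD
      by (simp del: lp_point.simps)
  qed
  then show ?thesis by (simp add: feasible_def moment_lp_def)
qed


section \<open>The linear program attains the same values as the moment problem\<close>

lemma integral_point_measure_real:
  fixes p g :: "'a \<Rightarrow> real"
  assumes "finite S" "\<And>s. s \<in> S \<Longrightarrow> 0 \<le> p s"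
  shows "(\<integral>s. g s \<partial>point_measure S p) = (\<Sum>s\<in>S. g s * p s)"
  using assms by (subst lebesgue_integral_point_measure_finite) (auto simp: mult.commute)

lemma ambiguity_set_iff:
  assumes fin: "\<forall>i\<in>{1..dimN D}. finite (Xi D i)"
  shows "P \<in> ambiguity_set D \<longleftrightarrow> (\<exists>p. (\<forall>s\<in>outcomes D. 0 \<le> p s) \<and> (\<Sum>s\<in>outcomes D. p s) = (1::real) \<and>
    P = point_measure (outcomes D) p \<and>
    (\<forall>i\<in>{1..dimN D}. \<forall>l\<in>{1..numU D i}.
      (\<Sum>s\<in>outcomes D. funU D i l (s i) * p s) \<in> {gamma_lower D i l..gamma_upper D i l}) \<and>
    (\<forall>(i, j)\<in>pairs (dimN D). \<forall>l\<in>{1..numB D i j}.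
      (\<Sum>s\<in>outcomes D. funB D i j l (s i) (s j) * p s) \<le> gammaB D i j l))"
proof -
  have sub: "outcomes D \<subseteq> (\<Pi>\<^sub>E i\<in>{1..dimN D}. UNIV)"
    unfolding outcomes_def by (intro PiE_mono) auto
  note int = integral_point_measure_real[OF finite_outcomes[OF fin]]
  show ?thesis
    unfolding ambiguity_set_def mem_Collect_eq outcomes_def[symmetric]
      distributions_on_finite[OF finite_outcomes[OF fin] sub]
    using int by (intro iffI; elim conjE exE; intro exI conjI; assumption?; simp)
qed

lemma sum_MAX_quad_piece_ge:
  assumes nonneg: "\<And>k s. k \<in> {1..numK D} \<Longrightarrow> s \<in> S \<Longrightarrow> 0 \<le> c k s"
  shows "(\<Sum>k\<in>{1..numK D}. \<Sum>s\<in>S. quad_piece D k s * c k s) \<le>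
    (\<Sum>s\<in>S. (MAX k\<in>{1..numK D}. quad_piece D k s) * (\<Sum>k\<in>{1..numK D}. c k s))"
proof -
  have "(\<Sum>k\<in>{1..numK D}. \<Sum>s\<in>S. quad_piece D k s * c k s) \<le>
      (\<Sum>k\<in>{1..numK D}. \<Sum>s\<in>S. (MAX k\<in>{1..numK D}. quad_piece D k s) * c k s)"
    using nonneg by (intro sum_mono mult_right_mono Max_ge) auto
  also have "\<dots> = (\<Sum>s\<in>S. (MAX k\<in>{1..numK D}. quad_piece D k s) * (\<Sum>k\<in>{1..numK D}. c k s))"
    by (subst sum.swap) (simp add: sum_distrib_left)
  finally show ?thesis .
qed

text \<open>
  Each outcome carries its whole weight to one label, that of a maximising piece, so the
  expectation of the maximum splits into the expectations of the pieces.
\<close>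

lemma distribution_to_lp_point:
  assumes valid: "valid_data D" and fin: "\<forall>i\<in>{1..dimN D}. finite (Xi D i)"
    and P: "P \<in> ambiguity_set D"
  shows "\<exists>lam\<in>feasible (moment_lp D).
    (\<integral>s. (MAX k\<in>{1..numK D}. quad_piece D k s) \<partial>P) = objective (moment_lp D) lam"
proof -
  let ?K = "{1..numK D}" and ?S = "outcomes D"
  from P obtain p :: "(nat \<Rightarrow> real) \<Rightarrow> real"
    where p: "\<And>s. s \<in> ?S \<Longrightarrow> 0 \<le> p s" "(\<Sum>s\<in>?S. p s) = 1" and P_eq: "P = point_measure ?S p"
      and uni: "\<And>i l. i \<in> {1..dimN D} \<Longrightarrow> l \<in> {1..numU D i} \<Longrightarrow>
        (\<Sum>s\<in>?S. funU D i l (s i) * p s) \<in> {gamma_lower D i l..gamma_upper D i l}"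
      and biv: "\<And>i j l. (i, j) \<in> pairs (dimN D) \<Longrightarrow> l \<in> {1..numB D i j} \<Longrightarrow>
        (\<Sum>s\<in>?S. funB D i j l (s i) (s j) * p s) \<le> gammaB D i j l"
    unfolding ambiguity_set_iff[OF fin] by blast
  have "\<exists>k\<in>?K. quad_piece D k s = (MAX k\<in>?K. quad_piece D k s)" for s
  proof -
    have "?K \<noteq> {}" using valid unfolding valid_data_def by simp
    then have "(MAX k\<in>?K. quad_piece D k s) \<in> (\<lambda>k. quad_piece D k s) ` ?K" by (intro Max_in) auto
    then show ?thesis by (metis imageE)
  qed
  then obtain best where best: "\<And>s. best s \<in> ?K"
    "\<And>s. quad_piece D (best s) s = (MAX k\<in>?K. quad_piece D k s)" by metis
  define c where "c k s = (if best s = k then p s else 0)" for k s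
  \<comment> \<open>With \<open>g\<close> independent of the label, this says that forgetting the label recovers \<open>p\<close>.\<close>
  have collapse: "(\<Sum>k\<in>?K. \<Sum>s\<in>?S. g k s * c k s) = (\<Sum>s\<in>?S. g (best s) s * p s)"
    for g :: "nat \<Rightarrow> (nat \<Rightarrow> real) \<Rightarrow> real"
  proof -
    have "(\<Sum>k\<in>?K. \<Sum>s\<in>?S. g k s * c k s) = (\<Sum>s\<in>?S. \<Sum>k\<in>?K. g k s * c k s)" by (rule sum.swap)
    also have "\<dots> = (\<Sum>s\<in>?S. g (best s) s * p s)"
    proof (rule sum.cong[OF refl])
      fix s
      have "(\<Sum>k\<in>?K. g k s * c k s) = (\<Sum>k\<in>?K. if best s = k then g k s * p s else 0)"
        unfolding c_def by (intro sum.cong) auto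
      then show "(\<Sum>k\<in>?K. g k s * c k s) = g (best s) s * p s"
        using best(1)[of s] by simp
    qed
    finally show ?thesis .
  qed
  have "lp_point D c \<in> feasible (moment_lp D)"
  proof (rule lp_point_feasible[OF fin])
    show "0 \<le> c k s" if "s \<in> ?S" for k s using p(1)[OF that] by (simp add: c_def)
    show "(\<Sum>k\<in>?K. \<Sum>s\<in>?S. c k s) = 1" using collapse[of "\<lambda>_ _. 1"] p(2) by simp
  qed (use collapse[of "\<lambda>_ s. h s" for h] uni biv in \<open>simp_all only:\<close>)
  moreover have "(\<integral>s. (MAX k\<in>?K. quad_piece D k s) \<partial>P) = objective (moment_lp D) (lp_point D c)"
  proof -
    have "(\<integral>s. (MAX k\<in>?K. quad_piece D k s) \<partial>P) = (\<Sum>s\<in>?S. quad_piece D (best s) s * p s)"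
      unfolding P_eq best(2)
      by (rule integral_point_measure_real[OF finite_outcomes[OF fin] p(1)])
    also have "\<dots> = (\<Sum>k\<in>?K. \<Sum>s\<in>?S. quad_piece D k s * c k s)"
      by (rule collapse[symmetric])
    also have "\<dots> = objective (moment_lp D) (lp_point D c)"
      unfolding moment_lp_def by (simp only: max_problem.simps lp_objective_lp_point[OF valid fin])
    finally show ?thesis .
  qed
  ultimately show ?thesis by blast
qed

text \<open>
  The rearrangement inequality for two pairs: the product sum is largest when both pairs are
  ordered in the same way.
\<close>

lemma submodular_on_neg_product:
  assumes "0 \<le> (a::real)"
  shows "submodular_on X Y (\<lambda>x y. - (2 * a * x * y))"
proof -
  have "x * y + x' * y' \<le> min x x' * min y y' + max x x' * max y y'" for x y x' y' :: real
  proof -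
    have "x * y + x' * y' \<le> x * y' + x' * y" if "0 \<le> (x' - x) * (y - y')" for x y x' y' :: real
      using that by (simp add: algebra_simps)
    from this[of x' x y y'] show ?thesis
      by (cases "x \<le> x'"; cases "y \<le> y'")
        (auto simp: min_def max_def mult_nonneg_nonneg mult_nonpos_nonpos)
  qed
  from mult_left_mono[OF this, of "2 * a"] assms show ?thesis
    unfolding submodular_on_def by (simp add: algebra_simps)
qed

lemma feasible_moment_lpD:
  assumes "lam \<in> feasible (moment_lp D)"
  shows "(\<Sum>k\<in>{1..numK D}. lam (Lam0 k)) = 1"
    and "\<And>i k. i \<in> {1..dimN D} \<Longrightarrow> k \<in> {1..numK D} \<Longrightarrow>
      (\<Sum>x\<in>Xi D i. lam (Lam1 i k x)) = lam (Lam0 k)"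
    and "\<And>i l. i \<in> {1..dimN D} \<Longrightarrow> l \<in> {1..numU D i} \<Longrightarrow>
      (\<Sum>k\<in>{1..numK D}. \<Sum>x\<in>Xi D i. funU D i l x * lam (Lam1 i k x))
        \<in> {gamma_lower D i l..gamma_upper D i l}"
    and "\<And>i j k y. (i, j) \<in> pairs (dimN D) \<Longrightarrow> k \<in> {1..numK D} \<Longrightarrow> y \<in> Xi D j \<Longrightarrow>
      (\<Sum>x\<in>Xi D i. lam (Lam2 i j k x y)) = lam (Lam1 j k y)"
    and "\<And>i j k x. (i, j) \<in> pairs (dimN D) \<Longrightarrow> k \<in> {1..numK D} \<Longrightarrow> x \<in> Xi D i \<Longrightarrow>
      (\<Sum>y\<in>Xi D j. lam (Lam2 i j k x y)) = lam (Lam1 i k x)"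
    and "\<And>i j l. (i, j) \<in> pairs (dimN D) \<Longrightarrow> l \<in> {1..numB D i j} \<Longrightarrow>
      (\<Sum>k\<in>{1..numK D}. \<Sum>x\<in>Xi D i. \<Sum>y\<in>Xi D j. funB D i j l x y * lam (Lam2 i j k x y))
        \<le> gammaB D i j l"
    and "\<And>v. v \<in> lp_vars D \<Longrightarrow> 0 \<le> lam v"
proof -
  have con: "holds_sense (lp_sense r) (lp_lhs D r lam) (lp_rhs D r)" if "r \<in> lp_constraints D" for r
    using assms that unfolding feasible_def moment_lp_def by simp
  show "(\<Sum>k\<in>{1..numK D}. lam (Lam0 k)) = 1"
    using con[of Total] by (simp add: lp_constraints_def)
  show "(\<Sum>x\<in>Xi D i. lam (Lam1 i k x)) = lam (Lam0 k)"
    if "i \<in> {1..dimN D}" "k \<in> {1..numK D}" for i k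
    using con[of "Mass i k"] that by (simp add: lp_constraints_def image_iff)
  show "(\<Sum>k\<in>{1..numK D}. \<Sum>x\<in>Xi D i. funU D i l x * lam (Lam1 i k x))
      \<in> {gamma_lower D i l..gamma_upper D i l}"
    if "i \<in> {1..dimN D}" "l \<in> {1..numU D i}" for i l
    using con[of "Uni_lower i l"] con[of "Uni_upper i l"] that
    by (simp add: lp_constraints_def image_iff)
  show "(\<Sum>x\<in>Xi D i. lam (Lam2 i j k x y)) = lam (Lam1 j k y)"
    if "(i, j) \<in> pairs (dimN D)" "k \<in> {1..numK D}" "y \<in> Xi D j" for i j k y
    using con[of "Marginal_snd i j k y"] that by (simp add: lp_constraints_def image_iff)
  show "(\<Sum>y\<in>Xi D j. lam (Lam2 i j k x y)) = lam (Lam1 i k x)"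
    if "(i, j) \<in> pairs (dimN D)" "k \<in> {1..numK D}" "x \<in> Xi D i" for i j k x
    using con[of "Marginal_fst i j k x"] that by (simp add: lp_constraints_def image_iff)
  show "(\<Sum>k\<in>{1..numK D}. \<Sum>x\<in>Xi D i. \<Sum>y\<in>Xi D j. funB D i j l x y * lam (Lam2 i j k x y))
      \<le> gammaB D i j l"
    if "(i, j) \<in> pairs (dimN D)" "l \<in> {1..numB D i j}" for i j l
    using con[of "Bivariate i j l"] that by (simp add: lp_constraints_def image_iff)
  show "0 \<le> lam v" if "v \<in> lp_vars D" for v
    using con[of "Nonneg v"] that by (simp add: lp_constraints_def)
qed

text \<open>
  For each label \<open>k\<close>, the weights \<open>c k\<close> are the comonotone coupling of the univariate variables of
  \<open>lam\<close>. Their bivariate marginals take the place of the bivariate variables of \<open>lam\<close>; the last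
  conclusion gives the direction in which this moves submodular expectations.
\<close>

lemma feasible_lp_comonotone_weights:
  assumes fin: "\<forall>i\<in>{1..dimN D}. finite (Xi D i)" and lam: "lam \<in> feasible (moment_lp D)"
  obtains c where
    "\<And>k s. k \<in> {1..numK D} \<Longrightarrow> 0 \<le> c k s"
    "\<And>k. k \<in> {1..numK D} \<Longrightarrow> lp_point D c (Lam0 k) = lam (Lam0 k)"
    "\<And>i k x. i \<in> {1..dimN D} \<Longrightarrow> k \<in> {1..numK D} \<Longrightarrow> x \<in> Xi D i \<Longrightarrow>
      lp_point D c (Lam1 i k x) = lam (Lam1 i k x)"
    "\<And>i j k f. (i, j) \<in> pairs (dimN D) \<Longrightarrow> k \<in> {1..numK D} \<Longrightarrow> submodular_on (Xi D i) (Xi D j) f \<Longrightarrow>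
      (\<Sum>x\<in>Xi D i. \<Sum>y\<in>Xi D j. f x y * lp_point D c (Lam2 i j k x y)) \<le>
      (\<Sum>x\<in>Xi D i. \<Sum>y\<in>Xi D j. f x y * lam (Lam2 i j k x y))"
proof -
  let ?I = "{1..dimN D}" and ?K = "{1..numK D}" and ?S = "outcomes D"
  let ?U = "\<lambda>k i. upper_mass (Xi D i) (\<lambda>x. lam (Lam1 i k x))"
  note lamD = feasible_moment_lpD[OF lam]
  let ?coupling = "\<lambda>k c. (\<forall>s. 0 \<le> c s) \<and> (\<Sum>s\<in>?S. c s) = lam (Lam0 k) \<and>
      (\<forall>i\<in>?I. \<forall>x\<in>Xi D i. (\<Sum>s\<in>{s\<in>?S. s i = x}. c s) = lam (Lam1 i k x)) \<and>
      (\<forall>i\<in>?I. \<forall>j\<in>?I. \<forall>x\<in>Xi D i. \<forall>y\<in>Xi D j.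
        (\<Sum>s\<in>{s\<in>?S. x \<le> s i \<and> y \<le> s j}. c s) = min (?U k i x) (?U k j y))"
  have "\<exists>c. ?coupling k c" if k: "k \<in> ?K" for k
  proof (rule comonotone_coupling_exists[of ?I "Xi D" "\<lambda>i x. lam (Lam1 i k x)" "lam (Lam0 k)",
      folded outcomes_def])
    show "finite ?I" by simp
    show "finite (Xi D i)" if "i \<in> ?I" for i using fin that by blast
    show "0 \<le> lam (Lam1 i k x)" if "i \<in> ?I" "x \<in> Xi D i" for i x
      using lamD(7) that k by (auto simp: lp_vars_def)
    show "(\<Sum>x\<in>Xi D i. lam (Lam1 i k x)) = lam (Lam0 k)" if "i \<in> ?I" for i
      using lamD(2) that k by blast
    show "0 \<le> lam (Lam0 k)" using lamD(7) k by (auto simp: lp_vars_def)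
  qed blast
  then have "\<forall>k\<in>?K. \<exists>c. ?coupling k c" by blast
  from bchoice[OF this] obtain c where c: "\<And>k. k \<in> ?K \<Longrightarrow> ?coupling k (c k)" by blast
  show thesis
  proof (rule that)
    show "0 \<le> c k s" if "k \<in> ?K" for k s using c[OF that] by blast
    show "lp_point D c (Lam0 k) = lam (Lam0 k)" if "k \<in> ?K" for k using c[OF that] by simp
    show Lam1: "lp_point D c (Lam1 i k x) = lam (Lam1 i k x)"
      if "i \<in> ?I" "k \<in> ?K" "x \<in> Xi D i" for i k x using c[OF that(2)] that by simp
    fix i j k f
    assume ij: "(i, j) \<in> pairs (dimN D)" and k: "k \<in> ?K"
      and sub: "submodular_on (Xi D i) (Xi D j) f"
    have i: "i \<in> ?I" and j: "j \<in> ?I" using pairsD[OF ij] by auto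
    show "(\<Sum>x\<in>Xi D i. \<Sum>y\<in>Xi D j. f x y * lp_point D c (Lam2 i j k x y)) \<le>
      (\<Sum>x\<in>Xi D i. \<Sum>y\<in>Xi D j. f x y * lam (Lam2 i j k x y))"
    proof (rule comonotone_minimizes[where v = "\<lambda>x. lam (Lam1 i k x)" and w = "\<lambda>y. lam (Lam1 j k y)"])
      show "finite (Xi D i)" "finite (Xi D j)" using fin i j by auto
      show "submodular_on (Xi D i) (Xi D j) f" by (fact sub)
      show "0 \<le> lam (Lam2 i j k x y)" if "x \<in> Xi D i" "y \<in> Xi D j" for x y
        using lamD(7) that ij k by (auto simp: lp_vars_def)
      show "(\<Sum>y\<in>Xi D j. lam (Lam2 i j k x y)) = lam (Lam1 i k x)" if "x \<in> Xi D i" for x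
        using lamD(5)[OF ij k that] .
      show "(\<Sum>x\<in>Xi D i. lam (Lam2 i j k x y)) = lam (Lam1 j k y)" if "y \<in> Xi D j" for y
        using lamD(4)[OF ij k that] .
      show "(\<Sum>y\<in>Xi D j. lp_point D c (Lam2 i j k x y)) = lam (Lam1 i k x)" if "x \<in> Xi D i" for x
        using lp_point_marginals(3)[OF fin i j] Lam1[OF i k that] by simp
      show "(\<Sum>x\<in>Xi D i. lp_point D c (Lam2 i j k x y)) = lam (Lam1 j k y)" if "y \<in> Xi D j" for y
        using lp_point_marginals(2)[OF fin i j] Lam1[OF j k that] by simp
      fix s t assume st: "s \<in> Xi D i" "t \<in> Xi D j"
      let ?A = "{x\<in>Xi D i. s \<le> x}" and ?B = "{y\<in>Xi D j. t \<le> y}"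
      have "(\<Sum>x\<in>?A. \<Sum>y\<in>?B. lp_point D c (Lam2 i j k x y)) =
          (\<Sum>z\<in>{z\<in>?S. z i \<in> ?A \<and> z j \<in> ?B}. c k z)"
        using sum_lp_point_Lam2_subset[OF fin, of ?A ?B "\<lambda>_ _. 1"] fin i j by simp
      also have "{z\<in>?S. z i \<in> ?A \<and> z j \<in> ?B} = {z\<in>?S. s \<le> z i \<and> t \<le> z j}"
        using outcomesD i j by auto
      finally show "(\<Sum>x\<in>?A. \<Sum>y\<in>?B. lp_point D c (Lam2 i j k x y)) = min (?U k i s) (?U k j t)"
        using c[OF k] i j st by simp
    qed
  qed
qed

text \<open>
  The distribution is the mixture of the comonotone couplings over all labels. Submodularity of the moment
  functions keeps it in the ambiguity set, and the sign of the off-diagonal entries gives the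
  comparison of the values.
\<close>

lemma lp_point_to_distribution:
  assumes valid: "valid_data D" and offdiag: "offdiag_nonneg D"
    and fin: "\<forall>i\<in>{1..dimN D}. finite (Xi D i)" and lam: "lam \<in> feasible (moment_lp D)"
  shows "\<exists>P\<in>ambiguity_set D.
    objective (moment_lp D) lam \<le> (\<integral>s. (MAX k\<in>{1..numK D}. quad_piece D k s) \<partial>P)"
proof -
  let ?I = "{1..dimN D}" and ?K = "{1..numK D}" and ?S = "outcomes D"
  note lamD = feasible_moment_lpD[OF lam]
  obtain c where c_nonneg: "\<And>k s. k \<in> ?K \<Longrightarrow> 0 \<le> c k s"
    and c0: "\<And>k. k \<in> ?K \<Longrightarrow> lp_point D c (Lam0 k) = lam (Lam0 k)"
    and c1: "\<And>i k x. i \<in> ?I \<Longrightarrow> k \<in> ?K \<Longrightarrow> x \<in> Xi D i \<Longrightarrow>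
      lp_point D c (Lam1 i k x) = lam (Lam1 i k x)"
    and c2: "\<And>i j k f. (i, j) \<in> pairs (dimN D) \<Longrightarrow> k \<in> ?K \<Longrightarrow> submodular_on (Xi D i) (Xi D j) f \<Longrightarrow>
      (\<Sum>x\<in>Xi D i. \<Sum>y\<in>Xi D j. f x y * lp_point D c (Lam2 i j k x y)) \<le>
      (\<Sum>x\<in>Xi D i. \<Sum>y\<in>Xi D j. f x y * lam (Lam2 i j k x y))"
    using feasible_lp_comonotone_weights[OF fin lam] by blast
  define p where "p s = (\<Sum>k\<in>?K. c k s)" for s
  have p_nonneg: "0 \<le> p s" for s unfolding p_def using c_nonneg by (intro sum_nonneg) auto
  have p_sum: "(\<Sum>s\<in>?S. g s * p s) = (\<Sum>k\<in>?K. \<Sum>s\<in>?S. g s * c k s)" for g :: "_ \<Rightarrow> real"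
    unfolding p_def sum_distrib_left by (rule sum.swap)
  have "point_measure ?S p \<in> ambiguity_set D"
    unfolding ambiguity_set_iff[OF fin]
  proof (intro exI[of _ p] conjI ballI)
    have "(\<Sum>s\<in>?S. p s) = (\<Sum>k\<in>?K. lam (Lam0 k))"
      using p_sum[of "\<lambda>_. 1"] c0 by simp
    then show "(\<Sum>s\<in>?S. p s) = 1" using lamD(1) by simp
  next
    fix i l assume i: "i \<in> ?I" and l: "l \<in> {1..numU D i}"
    have "(\<Sum>s\<in>?S. funU D i l (s i) * p s) =
        (\<Sum>k\<in>?K. \<Sum>x\<in>Xi D i. funU D i l x * lp_point D c (Lam1 i k x))"
      unfolding p_sum sum_lp_point_Lam1[OF fin i] ..
    also have "\<dots> = (\<Sum>k\<in>?K. \<Sum>x\<in>Xi D i. funU D i l x * lam (Lam1 i k x))"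
      using c1[OF i] by (intro sum.cong refl arg_cong2[where f = "(*)"]) auto
    finally show "(\<Sum>s\<in>?S. funU D i l (s i) * p s) \<in> {gamma_lower D i l..gamma_upper D i l}"
      using lamD(3)[OF i l] by simp
  next
    fix z assume "z \<in> pairs (dimN D)"
    then obtain i j where z: "z = (i, j)" and ij: "(i, j) \<in> pairs (dimN D)" by (cases z) auto
    have "(\<Sum>s\<in>?S. funB D i j l (s i) (s j) * p s) \<le> gammaB D i j l"
      if l: "l \<in> {1..numB D i j}" for l
    proof -
      have sub: "submodular_on (Xi D i) (Xi D j) (funB D i j l)"
        using valid ij l unfolding valid_data_def by blast
      have "(\<Sum>s\<in>?S. funB D i j l (s i) (s j) * p s) =
          (\<Sum>k\<in>?K. \<Sum>x\<in>Xi D i. \<Sum>y\<in>Xi D j. funB D i j l x y * lp_point D c (Lam2 i j k x y))"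
        unfolding p_sum sum_lp_point_Lam2[OF fin pairsD(1,2)[OF ij]] ..
      also have "\<dots> \<le> (\<Sum>k\<in>?K. \<Sum>x\<in>Xi D i. \<Sum>y\<in>Xi D j. funB D i j l x y * lam (Lam2 i j k x y))"
        by (rule sum_mono) (rule c2[OF ij _ sub])
      also have "\<dots> \<le> gammaB D i j l" by (rule lamD(6)[OF ij l])
      finally show ?thesis .
    qed
    then show "case z of (i, j) \<Rightarrow> \<forall>l\<in>{1..numB D i j}.
        (\<Sum>s\<in>?S. funB D i j l (s i) (s j) * p s) \<le> gammaB D i j l"
      unfolding z by simp
  qed (use p_nonneg in auto)
  moreover have "objective (moment_lp D) lam \<le>
      (\<integral>s. (MAX k\<in>?K. quad_piece D k s) \<partial>point_measure ?S p)"
  proof -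
    have quad: "(\<Sum>x\<in>Xi D i. \<Sum>y\<in>Xi D j. 2 * quadA D k i j * x * y * lam (Lam2 i j k x y)) \<le>
        (\<Sum>x\<in>Xi D i. \<Sum>y\<in>Xi D j. 2 * quadA D k i j * x * y * lp_point D c (Lam2 i j k x y))"
      if ij: "(i, j) \<in> pairs (dimN D)" and k: "k \<in> ?K" for i j k
    proof -
      have "0 \<le> quadA D k i j" using offdiag pairsD[OF ij] k unfolding offdiag_nonneg_def by blast
      from c2[OF ij k submodular_on_neg_product[OF this]] show ?thesis
        unfolding minus_mult_left[symmetric] sum_negf by (simp only: neg_le_iff_le)
    qed
    have diag: "(\<Sum>i\<in>?I. \<Sum>x\<in>Xi D i. (quadA D k i i * x\<^sup>2 + linb D k i * x) * lam (Lam1 i k x)) =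
        (\<Sum>i\<in>?I. \<Sum>x\<in>Xi D i. (quadA D k i i * x\<^sup>2 + linb D k i * x) * lp_point D c (Lam1 i k x))"
      if "k \<in> ?K" for k
      using c1 that by (intro sum.cong refl arg_cong2[where f = "(*)"]) auto
    have "objective (moment_lp D) lam \<le> lp_objective D (lp_point D c)"
      unfolding moment_lp_def max_problem.simps lp_objective_def
    proof (rule sum_mono, intro add_mono)
      fix k assume k: "k \<in> ?K"
      show "(\<Sum>(i, j)\<in>pairs (dimN D). \<Sum>x\<in>Xi D i. \<Sum>y\<in>Xi D j.
            2 * quadA D k i j * x * y * lam (Lam2 i j k x y)) \<le>
          (\<Sum>(i, j)\<in>pairs (dimN D). \<Sum>x\<in>Xi D i. \<Sum>y\<in>Xi D j.
            2 * quadA D k i j * x * y * lp_point D c (Lam2 i j k x y))"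
        by (rule sum_mono, clarify, rule quad[OF _ k])
      show "constc D k * lam (Lam0 k) \<le> constc D k * lp_point D c (Lam0 k)"
        using c0[OF k] by simp
    qed (simp only: diag)
    also have "\<dots> = (\<Sum>k\<in>?K. \<Sum>s\<in>?S. quad_piece D k s * c k s)"
      by (rule lp_objective_lp_point[OF valid fin])
    also have "\<dots> \<le> (\<Sum>s\<in>?S. (MAX k\<in>?K. quad_piece D k s) * p s)"
      unfolding p_def using c_nonneg by (rule sum_MAX_quad_piece_ge)
    also have "\<dots> = (\<integral>s. (MAX k\<in>?K. quad_piece D k s) \<partial>point_measure ?S p)"
      using integral_point_measure_real[OF finite_outcomes[OF fin] p_nonneg] by simp
    finally show ?thesis .
  qed
  ultimately show ?thesis by blast
qed

lemma rho_star_eq_optimal_value: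
  assumes "valid_data D" "offdiag_nonneg D" "\<forall>i\<in>{1..dimN D}. finite (Xi D i)"
  shows "rho_star D = optimal_value (moment_lp D)"
  unfolding rho_star_def optimal_value_def
proof (rule antisym; rule SUP_mono)
  fix P assume "P \<in> ambiguity_set D"
  from distribution_to_lp_point[OF assms(1,3) this]
  show "\<exists>lam\<in>feasible (moment_lp D). ereal (\<integral>s. (MAX k\<in>{1..numK D}. quad_piece D k s) \<partial>P)
      \<le> ereal (objective (moment_lp D) lam)" by auto
next
  fix lam assume "lam \<in> feasible (moment_lp D)"
  from lp_point_to_distribution[OF assms this]
  show "\<exists>P\<in>ambiguity_set D. ereal (objective (moment_lp D) lam)
      \<le> ereal (\<integral>s. (MAX k\<in>{1..numK D}. quad_piece D k s) \<partial>P)" by auto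
qed

section \<open>Linearity and size of the program\<close>

lemma linear_form_on_cong:
  assumes "\<And>x. g x = h x" "linear_form_on V h"
  shows "linear_form_on V g"
  using assms unfolding linear_form_on_def by simp

lemma linear_form_on_var:
  assumes "finite V" "v \<in> V"
  shows "linear_form_on V (\<lambda>x. x v)"
  unfolding linear_form_on_def
proof (intro exI allI)
  fix x :: "'a \<Rightarrow> real"
  have "(\<Sum>w\<in>V. (if w = v then 1 else 0) * x w) = (\<Sum>w\<in>V. if w = v then x w else 0)"
    by (rule sum.cong) auto
  then show "x v = (\<Sum>w\<in>V. (if w = v then 1 else 0) * x w)" using assms by simp
qed

lemma linear_form_on_scale:
  assumes "linear_form_on V g"
  shows "linear_form_on V (\<lambda>x. r * g x)"
proof -
  obtain a where "\<And>x. g x = (\<Sum>v\<in>V. a v * x v)" using assms unfolding linear_form_on_def by blast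
  then show ?thesis
    unfolding linear_form_on_def
    by (intro exI[of _ "\<lambda>v. r * a v"]) (simp add: sum_distrib_left mult.assoc)
qed

lemma linear_form_on_add:
  assumes "linear_form_on V g" "linear_form_on V h"
  shows "linear_form_on V (\<lambda>x. g x + h x)"
proof -
  obtain a b where "\<And>x. g x = (\<Sum>v\<in>V. a v * x v)" "\<And>x. h x = (\<Sum>v\<in>V. b v * x v)"
    using assms unfolding linear_form_on_def by blast
  then show ?thesis
    unfolding linear_form_on_def
    by (intro exI[of _ "\<lambda>v. a v + b v"]) (simp add: sum.distrib distrib_right)
qed

lemma linear_form_on_diff:
  assumes "linear_form_on V g" "linear_form_on V h"
  shows "linear_form_on V (\<lambda>x. g x - h x)"
  using linear_form_on_add[OF assms(1) linear_form_on_scale[OF assms(2), of "-1"]] by simp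

lemma linear_form_on_sum:
  assumes "\<And>i. i \<in> A \<Longrightarrow> linear_form_on V (g i)"
  shows "linear_form_on V (\<lambda>x. \<Sum>i\<in>A. g i x)"
  using assms
proof (induction A rule: infinite_finite_induct)
  case (insert i A)
  then show ?case by (simp add: linear_form_on_add)
qed (auto simp: linear_form_on_def intro!: exI[of _ "\<lambda>_. 0"])

text \<open>
  Variables and constraints are images of finite dependent sums; in this form finiteness and the
  bounds on the cardinality are immediate.
\<close>

lemma lp_vars_eq_images:
  "lp_vars D = Lam0 ` {1..numK D}
    \<union> (\<lambda>(i, k, x). Lam1 i k x) ` (SIGMA i:{1..dimN D}. {1..numK D} \<times> Xi D i)
    \<union> (\<lambda>((i, j), k, x, y). Lam2 i j k x y) `
        (SIGMA z:pairs (dimN D). {1..numK D} \<times> Xi D (fst z) \<times> Xi D (snd z))"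
  unfolding lp_vars_def by (auto simp: image_iff Bex_def)

lemma lp_constraints_eq_images:
  "lp_constraints D = {Total}
    \<union> (\<lambda>(i, k). Mass i k) ` ({1..dimN D} \<times> {1..numK D})
    \<union> (\<lambda>(i, l). Uni_lower i l) ` (SIGMA i:{1..dimN D}. {1..numU D i})
    \<union> (\<lambda>(i, l). Uni_upper i l) ` (SIGMA i:{1..dimN D}. {1..numU D i})
    \<union> (\<lambda>((i, j), k, y). Marginal_snd i j k y) `
        (SIGMA z:pairs (dimN D). {1..numK D} \<times> Xi D (snd z))
    \<union> (\<lambda>((i, j), k, x). Marginal_fst i j k x) `
        (SIGMA z:pairs (dimN D). {1..numK D} \<times> Xi D (fst z))
    \<union> (\<lambda>((i, j), l). Bivariate i j l) `
        (SIGMA z:pairs (dimN D). {1..numB D (fst z) (snd z)})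
    \<union> Nonneg ` lp_vars D"
  unfolding lp_constraints_def by (auto simp: image_iff Bex_def)

lemma finite_Xi_pairs:
  assumes "\<forall>i\<in>{1..dimN D}. finite (Xi D i)" "z \<in> pairs (dimN D)"
  shows "finite (Xi D (fst z))" "finite (Xi D (snd z))"
  using assms pairsD(1,2)[of "fst z" "snd z" "dimN D"] by simp_all

lemma finite_lp_vars:
  assumes "\<forall>i\<in>{1..dimN D}. finite (Xi D i)"
  shows "finite (lp_vars D)"
  unfolding lp_vars_eq_images using assms finite_Xi_pairs[OF assms] finite_pairs
  by (intro finite_UnI finite_imageI finite_SigmaI) auto

lemma finite_lp_constraints:
  assumes "\<forall>i\<in>{1..dimN D}. finite (Xi D i)"
  shows "finite (lp_constraints D)"
  unfolding lp_constraints_eq_images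
  using assms finite_Xi_pairs[OF assms] finite_pairs finite_lp_vars[OF assms]
  by (intro finite_UnI finite_imageI finite_SigmaI) auto

lemma linear_program_moment_lp:
  assumes fin: "\<forall>i\<in>{1..dimN D}. finite (Xi D i)"
  shows "linear_program (moment_lp D)"
proof -
  let ?V = "lp_vars D"
  note intros = linear_form_on_add linear_form_on_diff linear_form_on_scale linear_form_on_sum
  have var: "linear_form_on ?V (\<lambda>x. x v)" if "v \<in> ?V" for v
    using linear_form_on_var[OF finite_lp_vars[OF fin] that] .
  have var0: "linear_form_on ?V (\<lambda>x. x (Lam0 k))" if "k \<in> {1..numK D}" for k
    using that by (intro var) (simp add: lp_vars_def)
  have var1: "linear_form_on ?V (\<lambda>x. x (Lam1 i k t))"
    if "i \<in> {1..dimN D}" "k \<in> {1..numK D}" "t \<in> Xi D i" for i k t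
    using that by (intro var) (simp add: lp_vars_def)
  have var2: "linear_form_on ?V (\<lambda>x. x (Lam2 i j k t u))"
    if "(i, j) \<in> pairs (dimN D)" "k \<in> {1..numK D}" "t \<in> Xi D i" "u \<in> Xi D j" for i j k t u
    using that by (intro var) (simp add: lp_vars_def)
  have pair: "linear_form_on ?V (\<lambda>x. case z of (i, j) \<Rightarrow> g i j x)"
    if "\<And>i j. (i, j) \<in> pairs (dimN D) \<Longrightarrow> linear_form_on ?V (g i j)" "z \<in> pairs (dimN D)"
    for g :: "nat \<Rightarrow> nat \<Rightarrow> (lp_var \<Rightarrow> real) \<Rightarrow> real" and z
    using that by (cases z) auto
  have "linear_form_on ?V (lp_objective D)"
    by (rule linear_form_on_cong[OF lp_objective_def], intro intros pair)
      (assumption | rule var0 var1 var2)+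
  moreover have "linear_form_on ?V (lp_lhs D r)" if r: "r \<in> lp_constraints D" for r
  proof (cases r)
    case Total
    show ?thesis
      unfolding Total by (rule linear_form_on_cong[OF lp_lhs.simps(1)]) (intro intros var0)
  next
    case (Mass i k)
    then have "i \<in> {1..dimN D}" "k \<in> {1..numK D}" using r by (auto simp: lp_constraints_def)
    then show ?thesis
      unfolding Mass by (intro linear_form_on_cong[OF lp_lhs.simps(2)] intros var0 var1)
  next
    case (Uni_lower i l)
    then have "i \<in> {1..dimN D}" using r by (auto simp: lp_constraints_def)
    then show ?thesis
      unfolding Uni_lower by (intro linear_form_on_cong[OF lp_lhs.simps(3)] intros var1)
  next
    case (Uni_upper i l)
    then have "i \<in> {1..dimN D}" using r by (auto simp: lp_constraints_def)
    then show ?thesis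
      unfolding Uni_upper by (intro linear_form_on_cong[OF lp_lhs.simps(4)] intros var1)
  next
    case (Marginal_snd i j k y)
    then have "(i, j) \<in> pairs (dimN D)" "j \<in> {1..dimN D}" "k \<in> {1..numK D}" "y \<in> Xi D j"
      using r by (auto simp: lp_constraints_def pairs_def)
    then show ?thesis
      unfolding Marginal_snd by (intro linear_form_on_cong[OF lp_lhs.simps(5)] intros var1 var2)
  next
    case (Marginal_fst i j k x)
    then have "(i, j) \<in> pairs (dimN D)" "i \<in> {1..dimN D}" "k \<in> {1..numK D}" "x \<in> Xi D i"
      using r by (auto simp: lp_constraints_def pairs_def)
    then show ?thesis
      unfolding Marginal_fst by (intro linear_form_on_cong[OF lp_lhs.simps(6)] intros var1 var2)
  next
    case (Bivariate i j l)
    then have "(i, j) \<in> pairs (dimN D)" using r by (auto simp: lp_constraints_def)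
    then show ?thesis
      unfolding Bivariate by (intro linear_form_on_cong[OF lp_lhs.simps(7)] intros var2)
  next
    case (Nonneg v)
    then have "v \<in> ?V" using r by (auto simp: lp_constraints_def)
    then show ?thesis
      unfolding Nonneg by (intro linear_form_on_cong[OF lp_lhs.simps(8)] var)
  qed
  ultimately show ?thesis
    unfolding linear_program_def moment_lp_def
    using finite_lp_vars[OF fin] finite_lp_constraints[OF fin] by simp
qed

lemma card_image_Sigma_le:
  assumes "finite A" "\<And>a. a \<in> A \<Longrightarrow> finite (B a)" "\<And>a. a \<in> A \<Longrightarrow> card (B a) \<le> b"
  shows "card (f ` (SIGMA a:A. B a)) \<le> card A * b"
proof -
  have "card (f ` (SIGMA a:A. B a)) \<le> card (SIGMA a:A. B a)"
    using assms by (intro card_image_le finite_SigmaI) auto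
  also have "\<dots> = (\<Sum>a\<in>A. card (B a))" using assms by (intro card_SigmaI) auto
  also have "\<dots> \<le> card A * b" using sum_bounded_above[of A "\<lambda>a. card (B a)" b] assms(3) by simp
  finally show ?thesis .
qed

lemma card_pairs_le: "card (pairs N) \<le> N * N"
proof -
  have "card (pairs N) \<le> card ({1..N} \<times> {1..N})"
    by (intro card_mono) (auto simp: pairs_def)
  then show ?thesis by (simp add: card_cartesian_product)
qed

lemma card_lp_le:
  assumes fin: "\<forall>i\<in>{1..dimN D}. finite (Xi D i)"
  defines "N \<equiv> dimN D" and "K \<equiv> numK D"
    and "m \<equiv> SUP i\<in>{1..dimN D}. card (Xi D i)"
    and "L \<equiv> SUP i\<in>{1..dimN D}. numU D i"
    and "M \<equiv> SUP (i, j)\<in>pairs (dimN D). numB D i j"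
  shows "card (lp_vars D) \<le> K + N * (K * m) + N * N * (K * (m * m))"
    and "card (lp_constraints D) \<le> 1 + N * K + 2 * (N * L) + 2 * (N * N * (K * m)) + N * N * M
      + (K + N * (K * m) + N * N * (K * (m * m)))"
proof -
  have m: "card (Xi D i) \<le> m" if "i \<in> {1..N}" for i
    unfolding m_def using that by (intro cSUP_upper) (auto simp: N_def)
  have L: "numU D i \<le> L" if "i \<in> {1..N}" for i
    unfolding L_def using that by (intro cSUP_upper) (auto simp: N_def)
  have M: "numB D (fst z) (snd z) \<le> M" if "z \<in> pairs N" for z
    unfolding M_def case_prod_unfold using that finite_pairs
    by (intro cSUP_upper bdd_above_finite finite_imageI) (auto simp: N_def)
  have z: "fst z \<in> {1..N}" "snd z \<in> {1..N}" if "z \<in> pairs N" for z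
    using pairsD(1,2)[of "fst z" "snd z" N] that by simp_all
  have finN: "finite (Xi D i)" if "i \<in> {1..N}" for i using fin that by (simp add: N_def)
  have over_pairs: "card (f ` (SIGMA z:pairs N. B z)) \<le> N * N * b"
    if "\<And>z. z \<in> pairs N \<Longrightarrow> finite (B z)" "\<And>z. z \<in> pairs N \<Longrightarrow> card (B z) \<le> b"
    for f :: "(nat \<times> nat) \<times> 'a \<Rightarrow> 'b" and B b
    using card_image_Sigma_le[of "pairs N" B b f] finite_pairs[of N] that
      mult_le_mono1[OF card_pairs_le[of N], of b] by (meson le_trans)
  have over_indices: "card (f ` (SIGMA i:{1..N}. B i)) \<le> N * b"
    if "\<And>i. i \<in> {1..N} \<Longrightarrow> finite (B i)" "\<And>i. i \<in> {1..N} \<Longrightarrow> card (B i) \<le> b"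
    for f :: "nat \<times> 'a \<Rightarrow> 'b" and B b
    using card_image_Sigma_le[of "{1..N}" B b f] that by simp
  show vars: "card (lp_vars D) \<le> K + N * (K * m) + N * N * (K * (m * m))"
    unfolding lp_vars_eq_images N_def[symmetric] K_def[symmetric]
  proof (intro order.trans[OF card_Un_le] add_mono over_indices over_pairs)
    show "card (Lam0 ` {1..K}) \<le> K" using card_image_le[of "{1..K}" Lam0] by simp
  qed (use m z finN in \<open>auto simp: card_cartesian_product intro!: mult_le_mono\<close>)
  have "card (lp_constraints D) \<le>
      1 + N * K + N * L + N * L + N * N * (K * m) + N * N * (K * m) + N * N * M
      + (K + N * (K * m) + N * N * (K * (m * m)))"
    unfolding lp_constraints_eq_images N_def[symmetric] K_def[symmetric]
  proof (intro order.trans[OF card_Un_le] add_mono over_indices over_pairs)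
    show "card (Nonneg ` lp_vars D) \<le> K + N * (K * m) + N * N * (K * (m * m))"
      using card_image_le[OF finite_lp_vars[OF fin], of Nonneg] vars by (rule order.trans)
  qed (use m z finN L M in \<open>auto simp: card_cartesian_product intro!: mult_le_mono\<close>)
  then show "card (lp_constraints D) \<le>
      1 + N * K + 2 * (N * L) + 2 * (N * N * (K * m)) + N * N * M
      + (K + N * (K * m) + N * N * (K * (m * m)))"
    by simp
qed

theorem theorem4p3:
  shows "\<exists>p q. real_polynomial_function p \<and> real_polynomial_function q \<and>
    (\<forall>D. valid_data D \<longrightarrow> offdiag_nonneg D \<longrightarrow> (\<forall>i\<in>{1..dimN D}. finite (Xi D i)) \<longrightarrow>
       rho_star D = optimal_value (moment_lp D) \<and>
       linear_program (moment_lp D) \<and>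
       real (card (vars (moment_lp D))) \<le> p (size_parameters D) \<and>
       real (card (constraints (moment_lp D))) \<le> q (size_parameters D))"
proof -
  define N K m L M :: "real \<times> real \<times> real \<times> real \<times> real \<Rightarrow> real"
    where "N = (\<lambda>z. fst z)" and "K = (\<lambda>z. fst (snd z))" and "m = (\<lambda>z. fst (snd (snd z)))"
      and "L = (\<lambda>z. fst (snd (snd (snd z))))" and "M = (\<lambda>z. snd (snd (snd (snd z))))"
  define p where "p z = K z + N z * (K z * m z) + N z * N z * (K z * (m z * m z))" for z
  define q where "q z = 1 + N z * K z + 2 * (N z * L z) + 2 * (N z * N z * (K z * m z))
    + N z * N z * M z + p z" for z
  have coords: "real_polynomial_function N" "real_polynomial_function K"
    "real_polynomial_function m" "real_polynomial_function L" "real_polynomial_function M"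
    unfolding N_def K_def m_def L_def M_def
    by (intro real_polynomial_function.intros(1) bounded_linear_fst bounded_linear_snd
        bounded_linear_compose[OF bounded_linear_fst] bounded_linear_compose[OF bounded_linear_snd])+
  note poly = real_polynomial_function.intros(2-4) coords
  have p: "real_polynomial_function p" unfolding p_def by (intro poly)
  have q: "real_polynomial_function q" unfolding q_def by (intro poly p)
  have "real (card (vars (moment_lp D))) \<le> p (size_parameters D) \<and>
      real (card (constraints (moment_lp D))) \<le> q (size_parameters D)"
    if "\<forall>i\<in>{1..dimN D}. finite (Xi D i)" for D
    using card_lp_le[OF that, THEN of_nat_mono, where 'a = real]
    by (simp add: moment_lp_def size_parameters_def p_def q_def N_def K_def m_def L_def M_def)
  then show ?thesis
    using p q rho_star_eq_optimal_value linear_program_moment_lp by blast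
qed

end
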